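(* Consider problem (OC) in which the system is the linear system $\dot x=\mathrm{diag}(a_1,\dots,a_n)\,x+1_{n\times1}u$ (i.e. $f(x)=\mathrm{diag}(a_1,\dots,a_n)x$ and $g\equiv 1_{n\times 1}$, with $a_1,\dots,a_n\in\mathbb{R}$), with an optimal trajectory $(x^\star,u^\star)$ and multipliers as in hypothesis (P). Suppose Assumptions 1, 4(a) and 5 hold, and suppose: (a) there exist $j_1,j_2\in\{1,\dots,n\}$ with $\lambda_{j_1}(t_f^-)>\lambda_{j_2}(t_f^-)$ and $a_{j_1}>a_{j_2}$; (b) for all $k,j\in\{1,\dots,n\}$, $\lambda_k(t_f^-)\ge\lambda_j(t_f^-)$ implies $a_k\ge a_j$; (c) for every index $i$ such that $\bar s_i$ is active on some time interval of positive length, for a.e. $t$ in the set of times at which $\bar s_i$ is active: (i) $\partial\bar s_i^\star[t]/\partial u>0$, and (ii) for all $k,j\in\{1,\dots,n\}$, $\lambda_k(t_f^-)\ge\lambda_j(t_f^-)$ implies $p^\star_{i,k}[t]\le p^\star_{i,j}[t]$. Then $\lambda(t)^\top g^\star[t]>0$ and $u^\star(t)=\max\mathcal D(x^\star(t))$ for a.e. $t\in[0,t_f]$, and the optimal trajectory is bang-ride.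
   Context: Setting. Fix $n\ge1$. System: $\dot x(t)=F(x(t),u(t)):=f(x(t))+g(x(t))u(t)$ with $f,g:\mathbb{R}^n\to\mathbb{R}^n$, state $x(t)\in\mathbb{R}^n$, scalar input $u(t)\in\mathbb{R}$. Admissible inputs are piecewise continuous $u:[0,t_f]\to\mathbb{R}$ with finitely many discontinuities, continuous at $0$ and $t_f$, and equal to their left limit at each discontinuity in $(0,t_f)$. Problem (OC): minimize $\phi(x(t_f))+\int_0^{t_f} l(x(t))\,dt$ over admissible $u$ (and over $t_f$ when the terminal time is free) subject to the dynamics, $x(0)=x_0$, $s(x(t),u(t))\le 0$ and $h(x(t))\le 0$ for all $t\in[0,t_f]$, and $z(x(t_f))\ge 0$, where $l,\phi:\mathbb{R}^n\to\mathbb{R}$, $s:\mathbb{R}^n\times\mathbb{R}\to\mathbb{R}^{c_s}$ (mixed constraints, among whose components are the input bounds $u_{\min}-u\le0$ and $u-u_{\max}\le 0$), $h:\mathbb{R}^n\to\mathbb{R}^{c_h}$ (state constraints), $z:\mathbb{R}^n\to\mathbb{R}^{c_z}$; vector inequalities are componentwise. $(x^\star,u^\star)$ denotes an optimal trajectory; for a function $q(x,u)$ write $q^\star[t]:=q(x^\star(t),u^\star(t))$, and $q_x,q_u$ for its partial derivatives (Jacobians). Let $\dot h(x,u):=J_h(x)F(x,u)$ with $J_h$ the Jacobian of $h$, and set $\bar s_i:=s_i$ for $1\le i\le c_s$ and $\bar s_i:=\dot h_{i-c_s}$ for $c_s<i\le c_s+c_h$. A mixed constraint $s_i$ is active at $t$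 if $s_i^\star[t]=0$; a state constraint $h_i$ is active at $t$ if $h_i(x^\star(t))=0$; $\bar s_i$ is called active at $t$ iff $s_i$ (for $i\le c_s$), resp. $h_{i-c_s}$ (for $i>c_s$), is active at $t$. The state-dependent control set is $\mathcal D(x):=\{u\in\mathbb{R}: s(x,u)\le 0,\ \dot h_i(x,u)\le 0 \text{ for every } i \text{ with } h_i(x)=0\}$. The optimal trajectory is called bang-ride if for a.e. $t\in[0,t_f]$ at least one constraint (some $s_i$ or some $h_i$) is active at $t$. The relative sensitivity of $\bar s_i$ with respect to $x_j$ is $p_{i,j}(x,u):=\big[\partial\bar s_i(x,u)/\partial u\big]^{-1}\,\partial\bar s_i(x,u)/\partial x_j$, and $p^\star_{i,j}[t]:=p_{i,j}(x^\star(t),u^\star(t))$. An entry time is a time $\tau$ such that some $h_i$ is inactive on a nonempty open interval ending at $\tau$ and active on an interval $[\tau,\tau+\epsilon)$, $\epsilon>0$; it is assumed there are no contact times (instants at which a state constraint is active but inactive immediately before and after). Assumption 1 (standard regularity): (a) $f,g,\phi,s,l,z$ are continuously differentiable and each component of $h$ is $C^2$; (b) for a.e. $t\in[0,t_f]$ the matrix $\begin{bmatrix} s^\star_u[t] & \mathrm{diag}(s^\star[t]) & 0\\ \dot h^\star_u[t] & 0 & \mathrm{diag}(h(x^\star(t)))\end{bmatrix}$ has rank $c_s+c_h$. Assumption 4(a): $t_f$ is free or fixed, $l\equiv 0$, and $\mathrm{rank}\begin{bmatrix}\phi_x & 0\\ z_x & \mathrm{diag}(z)\end{bmatrix}\Big|_{x^\star(t_f)}=c_z+1$.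 Assumption 5 (switching of state constraints): Define $\mathcal G^\star(t):=\{i: h_i(x^\star(t))=0\}$, $\mathcal G^\star(t^+):=\{i:\text{there exist } k>t \text{ arbitrarily close to } t \text{ with } h_i(x^\star(k))=0\}$, $\mathcal G^\star(t^-):=\{i:\text{there exist } k<t \text{ arbitrarily close to } t \text{ with } h_i(x^\star(k))=0\}$. Assumption 5 requires: (a) $\mathcal G^\star(0)=\mathcal G^\star(0^+)$ and $\mathcal G^\star(t_f)=\mathcal G^\star(t_f^-)$; (b) at each entry time $\tau\in(0,t_f)$, $u^\star$ is discontinuous at $\tau$. (Vacuous if there are no state constraints.) Hypothesis (P) (Pontryagin necessary conditions, taken as given): there exist a constant $\lambda_0\le 0$, a piecewise absolutely continuous $\lambda:[0,t_f]\to\mathbb{R}^n$ (the costate), piecewise continuous $\mu:[0,t_f]\to\mathbb{R}^{c_s}$ and $\nu:[0,t_f]\to\mathbb{R}^{c_h}$, vectors $\alpha\in\mathbb{R}^{c_z}$, $\gamma\in\mathbb{R}^{c_h}$, and a vector $\eta(\tau_i)\in\mathbb{R}^{c_h}$ for each discontinuity time $\tau_i$ of $\lambda$, such that, with Hamiltonian $H(x,u,\lambda_0,\lambda)=\lambda_0 l(x)+\lambda^\top F(x,u)$ and Lagrangian $L=H+\mu^\top s+\nu^\top \dot h$: (i) for every $t$, $(\lambda_0,\lambda(t),\mu(t),\nu(t),\alpha,\gamma,\eta(\tau_1),\eta(\tau_2),\dots)\neq 0$; (ii) for a.e. $t$: $H(x^\star(t),u^\star(t),\lambda_0,\lambda(t))=\max_{u\in\mathcal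 D(x^\star(t))}H(x^\star(t),u,\lambda_0,\lambda(t))$; $\lambda(t)^\top g^\star[t]+\mu(t)^\top s^\star_u[t]+\nu(t)^\top\dot h^\star_u[t]=0$; $\dot\lambda(t)^\top=-\lambda_0 l_x(x^\star(t))-\lambda(t)^\top F_x^\star[t]-\mu(t)^\top s^\star_x[t]-\nu(t)^\top\dot h^\star_x[t]$; $\mu(t)\le 0$, $\mu(t)^\top s^\star[t]=0$; $\nu(t)\le0$, $\nu(t)^\top h(x^\star(t))=0$; (iii) $\lambda(t_f^-)^\top=\lambda_0\phi_x(x^\star(t_f))+\alpha^\top z_x(x^\star(t_f))+\gamma^\top h_x(x^\star(t_f))$, $\alpha\ge0$, $\gamma\le 0$, $\alpha^\top z(x^\star(t_f))=\gamma^\top h(x^\star(t_f))=0$; (iv) $\lambda$ can be discontinuous only at entry times $\tau_i$, where $\lambda(\tau_i^-)^\top=\lambda(\tau_i^+)^\top+\eta(\tau_i)^\top h_x(x^\star(\tau_i))$, $\eta(\tau_i)\le 0$, $\eta(\tau_i)^\top h(x^\star(\tau_i))=0$; (v) if $t_f$ is free, $H(x^\star(t),u^\star(t),\lambda_0,\lambda(t))=0$ for all $t\in[0,t_f]$. Fact (F), taken as part of the necessary-condition theory: under Assumption 5, $\lambda$ is continuous on $[0,t_f]$ (in particular $\lambda(t_f^-)=\lambda(t_f)$), all jump vectors $\eta(\tau_i)$ vanish, and $\gamma=0$. *)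

theory Defs
  imports "HOL-Analysis.Analysis"
begin

definition C1_fun :: "('a::euclidean_space \<Rightarrow> real) \<Rightarrow> bool" where
  "C1_fun q \<longleftrightarrow> (\<forall>p. q differentiable (at p)) \<and>
     (\<forall>b\<in>Basis. continuous_on UNIV (\<lambda>p. frechet_derivative q (at p) b))"

definition C2_fun :: "('a::euclidean_space \<Rightarrow> real) \<Rightarrow> bool" where
  "C2_fun q \<longleftrightarrow> C1_fun q \<and> (\<forall>b\<in>Basis. C1_fun (\<lambda>p. frechet_derivative q (at p) b))"

definition pd_u :: "((real^'n) \<times> real \<Rightarrow> real) \<Rightarrow> real^'n \<Rightarrow> real \<Rightarrow> real" where
  "pd_u q x u = frechet_derivative q (at (x, u)) (0, 1)"

definition pd_x :: "((real^'n) \<times> real \<Rightarrow> real) \<Rightarrow> real^'n \<Rightarrow> real \<Rightarrow> 'n \<Rightarrow> real" where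
  "pd_x q x u j = frechet_derivative q (at (x, u)) (axis j 1, 0)"

definition grad_x :: "(real^'n \<Rightarrow> real) \<Rightarrow> real^'n \<Rightarrow> 'n \<Rightarrow> real" where
  "grad_x r x j = frechet_derivative r (at x) (axis j 1)"

definition jacF_col :: "(real^'n \<Rightarrow> real \<Rightarrow> real^'n) \<Rightarrow> real^'n \<Rightarrow> real \<Rightarrow> 'n \<Rightarrow> real^'n" where
  "jacF_col F x u j = frechet_derivative (\<lambda>y. F y u) (at x) (axis j 1)"

definition hdot :: "(real^'n \<Rightarrow> nat \<Rightarrow> real) \<Rightarrow> (real^'n \<Rightarrow> real \<Rightarrow> real^'n) \<Rightarrow> nat
    \<Rightarrow> real^'n \<Rightarrow> real \<Rightarrow> real" where
  "hdot h F i x u = frechet_derivative (\<lambda>y. h y i) (at x) (F x u)"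

definition sbar :: "(real^'n \<Rightarrow> real \<Rightarrow> nat \<Rightarrow> real) \<Rightarrow> (real^'n \<Rightarrow> nat \<Rightarrow> real)
    \<Rightarrow> (real^'n \<Rightarrow> real \<Rightarrow> real^'n) \<Rightarrow> nat \<Rightarrow> nat \<Rightarrow> (real^'n) \<times> real \<Rightarrow> real" where
  "sbar s h F cs i = (\<lambda>(x, u). if i < cs then s x u i else hdot h F (i - cs) x u)"

definition ctrl_set :: "(real^'n \<Rightarrow> real \<Rightarrow> nat \<Rightarrow> real) \<Rightarrow> (real^'n \<Rightarrow> nat \<Rightarrow> real)
    \<Rightarrow> (real^'n \<Rightarrow> real \<Rightarrow> real^'n) \<Rightarrow> nat \<Rightarrow> nat \<Rightarrow> real^'n \<Rightarrow> real set" where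
  "ctrl_set s h F cs ch x =
     {u. (\<forall>i<cs. s x u i \<le> 0) \<and> (\<forall>i<ch. h x i = 0 \<longrightarrow> hdot h F i x u \<le> 0)}"

definition rel_sens :: "(real^'n \<Rightarrow> real \<Rightarrow> nat \<Rightarrow> real) \<Rightarrow> (real^'n \<Rightarrow> nat \<Rightarrow> real)
    \<Rightarrow> (real^'n \<Rightarrow> real \<Rightarrow> real^'n) \<Rightarrow> nat \<Rightarrow> nat \<Rightarrow> real^'n \<Rightarrow> real \<Rightarrow> 'n \<Rightarrow> real" where
  "rel_sens s h F cs i x u j =
     inverse (pd_u (sbar s h F cs i) x u) * pd_x (sbar s h F cs i) x u j"

definition sbar_active :: "(real^'n \<Rightarrow> real \<Rightarrow> nat \<Rightarrow> real) \<Rightarrow> (real^'n \<Rightarrow> nat \<Rightarrow> real)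
    \<Rightarrow> nat \<Rightarrow> (real \<Rightarrow> real^'n) \<Rightarrow> (real \<Rightarrow> real) \<Rightarrow> nat \<Rightarrow> real \<Rightarrow> bool" where
  "sbar_active s h cs x u i t \<longleftrightarrow>
     (if i < cs then s (x t) (u t) i = 0 else h (x t) (i - cs) = 0)"

definition full_row_rank :: "nat \<Rightarrow> 'c set \<Rightarrow> (nat \<Rightarrow> 'c \<Rightarrow> real) \<Rightarrow> bool" where
  "full_row_rank m C M \<longleftrightarrow>
     (\<forall>c. (\<forall>j\<in>C. (\<Sum>i<m. c i * M i j) = 0) \<longrightarrow> (\<forall>i<m. c i = 0))"

definition pw_cont :: "real \<Rightarrow> (real \<Rightarrow> 'a::topological_space) \<Rightarrow> bool" where
  "pw_cont T f \<longleftrightarrow> (\<exists>D. finite D \<and> D \<subseteq> {0..T} \<and>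
     (\<forall>t\<in>{0..T} - D. continuous (at t within {0..T}) f) \<and>
     (\<forall>d\<in>D. (0 < d \<longrightarrow> (\<exists>L. (f \<longlongrightarrow> L) (at_left d))) \<and>
             (d < T \<longrightarrow> (\<exists>L. (f \<longlongrightarrow> L) (at_right d)))))"

definition admissible_input :: "real \<Rightarrow> (real \<Rightarrow> real) \<Rightarrow> bool" where
  "admissible_input T u \<longleftrightarrow> (\<exists>D. finite D \<and> D \<subseteq> {0<..<T} \<and>
     (\<forall>t\<in>{0..T} - D. continuous (at t within {0..T}) u) \<and>
     (\<forall>d\<in>D. (u \<longlongrightarrow> u d) (at_left d) \<and> (\<exists>L. (u \<longlongrightarrow> L) (at_right d))))"

text \<open>x solves xdot = F(x,u), x(0) = x0 on [0,T] (continuous, derivative equation off a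
  finite set, which is the solution notion for piecewise continuous inputs).\<close>
definition is_solution :: "(real^'n \<Rightarrow> real \<Rightarrow> real^'n) \<Rightarrow> real^'n \<Rightarrow> real
    \<Rightarrow> (real \<Rightarrow> real) \<Rightarrow> (real \<Rightarrow> real^'n) \<Rightarrow> bool" where
  "is_solution F x0 T u x \<longleftrightarrow> x 0 = x0 \<and> continuous_on {0..T} x \<and>
     (\<exists>E. finite E \<and> (\<forall>t\<in>{0..T} - E.
        (x has_vector_derivative F (x t) (u t)) (at t within {0..T})))"

definition feasible :: "(real^'n \<Rightarrow> real \<Rightarrow> real^'n) \<Rightarrow> (real^'n \<Rightarrow> real \<Rightarrow> nat \<Rightarrow> real)
    \<Rightarrow> (real^'n \<Rightarrow> nat \<Rightarrow> real) \<Rightarrow> (real^'n \<Rightarrow> nat \<Rightarrow> real) \<Rightarrow> nat \<Rightarrow> nat \<Rightarrow> nat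
    \<Rightarrow> real^'n \<Rightarrow> real \<Rightarrow> (real \<Rightarrow> real^'n) \<Rightarrow> (real \<Rightarrow> real) \<Rightarrow> bool" where
  "feasible F s h z cs ch cz x0 T x u \<longleftrightarrow> 0 < T \<and> admissible_input T u \<and>
     is_solution F x0 T u x \<and>
     (\<forall>t\<in>{0..T}. (\<forall>i<cs. s (x t) (u t) i \<le> 0) \<and> (\<forall>i<ch. h (x t) i \<le> 0)) \<and>
     (\<forall>i<cz. 0 \<le> z (x T) i)"

definition oc_cost :: "(real^'n \<Rightarrow> real) \<Rightarrow> (real^'n \<Rightarrow> real) \<Rightarrow> real \<Rightarrow> (real \<Rightarrow> real^'n) \<Rightarrow> real" where
  "oc_cost phi l T x = phi (x T) + integral {0..T} (\<lambda>t. l (x t))"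

definition oc_optimal :: "bool \<Rightarrow> (real^'n \<Rightarrow> real \<Rightarrow> real^'n) \<Rightarrow> (real^'n \<Rightarrow> real)
    \<Rightarrow> (real^'n \<Rightarrow> real) \<Rightarrow> (real^'n \<Rightarrow> real \<Rightarrow> nat \<Rightarrow> real) \<Rightarrow> (real^'n \<Rightarrow> nat \<Rightarrow> real)
    \<Rightarrow> (real^'n \<Rightarrow> nat \<Rightarrow> real) \<Rightarrow> nat \<Rightarrow> nat \<Rightarrow> nat \<Rightarrow> real^'n
    \<Rightarrow> real \<Rightarrow> (real \<Rightarrow> real^'n) \<Rightarrow> (real \<Rightarrow> real) \<Rightarrow> bool" where
  "oc_optimal tf_free F phi l s h z cs ch cz x0 T x u \<longleftrightarrow>
     feasible F s h z cs ch cz x0 T x u \<and>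
     (\<forall>T' x' u'. (tf_free \<or> T' = T) \<longrightarrow> feasible F s h z cs ch cz x0 T' x' u' \<longrightarrow>
        oc_cost phi l T x \<le> oc_cost phi l T' x')"

definition abs_cont_on :: "real set \<Rightarrow> (real \<Rightarrow> 'a::real_normed_vector) \<Rightarrow> bool" where
  "abs_cont_on S f \<longleftrightarrow> (\<forall>e>0. \<exists>d>0. \<forall>I::(real \<times> real) set.
     finite I \<and> (\<forall>(a, b)\<in>I. a < b \<and> {a..b} \<subseteq> S) \<and>
     (\<forall>(a, b)\<in>I. \<forall>(c, d)\<in>I. (a, b) \<noteq> (c, d) \<longrightarrow> b \<le> c \<or> d \<le> a) \<and>
     (\<Sum>(a, b)\<in>I. b - a) < d \<longrightarrow> (\<Sum>(a, b)\<in>I. norm (f b - f a)) < e)"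

definition G_at :: "(real^'n \<Rightarrow> nat \<Rightarrow> real) \<Rightarrow> nat \<Rightarrow> (real \<Rightarrow> real^'n) \<Rightarrow> real \<Rightarrow> nat set" where
  "G_at h ch x t = {i. i < ch \<and> h (x t) i = 0}"

definition G_right :: "(real^'n \<Rightarrow> nat \<Rightarrow> real) \<Rightarrow> nat \<Rightarrow> (real \<Rightarrow> real^'n) \<Rightarrow> real \<Rightarrow> nat set" where
  "G_right h ch x t = {i. i < ch \<and> (\<forall>e>0. \<exists>k. t < k \<and> k < t + e \<and> h (x k) i = 0)}"

definition G_left :: "(real^'n \<Rightarrow> nat \<Rightarrow> real) \<Rightarrow> nat \<Rightarrow> (real \<Rightarrow> real^'n) \<Rightarrow> real \<Rightarrow> nat set" where
  "G_left h ch x t = {i. i < ch \<and> (\<forall>e>0. \<exists>k. t - e < k \<and> k < t \<and> h (x k) i = 0)}"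

definition entry_time :: "(real^'n \<Rightarrow> nat \<Rightarrow> real) \<Rightarrow> nat \<Rightarrow> real \<Rightarrow> (real \<Rightarrow> real^'n) \<Rightarrow> real \<Rightarrow> bool" where
  "entry_time h ch T x tau \<longleftrightarrow> (\<exists>i<ch.
     (\<exists>a. 0 \<le> a \<and> a < tau \<and> (\<forall>t\<in>{a<..<tau}. h (x t) i \<noteq> 0)) \<and>
     (\<exists>e>0. tau + e \<le> T \<and> (\<forall>t\<in>{tau..<tau + e}. h (x t) i = 0)))"

definition contact_time :: "(real^'n \<Rightarrow> nat \<Rightarrow> real) \<Rightarrow> nat \<Rightarrow> (real \<Rightarrow> real^'n) \<Rightarrow> real \<Rightarrow> bool" where
  "contact_time h ch x t \<longleftrightarrow> (\<exists>i<ch. h (x t) i = 0 \<and>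
     (\<exists>e>0. \<forall>k. 0 < \<bar>k - t\<bar> \<and> \<bar>k - t\<bar> < e \<longrightarrow> h (x k) i \<noteq> 0))"

end

theory Submission
  imports Defs
begin

text \<open>
  Write \<open>\<sigma> = \<Sum>\<^sub>j \<lambda>\<^sub>j = \<lambda>\<^sup>T g\<close> for the switching function. Stationarity and (c) give
  \<open>\<sigma> = \<Sum>\<^sub>i w\<^sub>i \<ge> 0\<close> with weights \<open>w\<^sub>i \<ge> 0\<close>, and \<open>\<lambda>\<^sub>j' = - a\<^sub>j \<lambda>\<^sub>j + P\<^sub>j\<close> where
  \<open>P\<^sub>j = \<Sum>\<^sub>i w\<^sub>i p\<^sub>i\<^sub>j\<close> is ordered oppositely to \<open>\<lambda>(t\<^sub>f)\<close>. The components of \<open>\<lambda>(t)\<close> need not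
  stay ordered for \<open>t < t\<^sub>f\<close>, so the order is propagated by duality instead: for fixed \<open>t\<^sub>0\<close>, let
  \<open>v\<^sub>j' = a\<^sub>j v\<^sub>j - m\<close> with \<open>m\<close> the mean of \<open>(a\<^sub>i v\<^sub>i)\<^sub>i\<close> and \<open>v(t\<^sub>0)\<close> the vector \<open>a\<close> minus its mean.
  This flow is symmetric on the sum-zero vectors, whence \<open>m \<ge> 0\<close>; therefore
  \<open>exp (- a\<^sub>j (t - t\<^sub>0)) v\<^sub>j(t)\<close> is increasing in \<open>a\<^sub>j\<close>, and \<open>v(t)\<close> changes sign only once along the
  order of \<open>\<lambda>(t\<^sub>f)\<close>. Consequently \<open>(v \<bullet> \<lambda>)' = - m \<sigma> + v \<bullet> P \<le> 0\<close> and \<open>v(t\<^sub>f) \<bullet> \<lambda>(t\<^sub>f) > 0\<close>, so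
  \<open>v(t\<^sub>0) \<bullet> \<lambda>(t\<^sub>0) > 0\<close>. If \<open>\<sigma>(t\<^sub>0) = 0\<close>, all weights vanish and this reads \<open>\<sigma>'(t\<^sub>0) < 0\<close>,
  which is impossible at an interior minimum of \<open>\<sigma> \<ge> 0\<close>. Hence \<open>\<sigma> > 0\<close> almost everywhere, the
  Hamiltonian is strictly increasing in \<open>u\<close>, and some multiplier is nonzero.
\<close>

section \<open>Absolutely continuous functions\<close>

lemma abs_cont_onD:
  assumes "abs_cont_on S f" "0 < e"
  obtains d where "0 < d"
    "\<And>I. finite I \<Longrightarrow> (\<And>a b. (a, b) \<in> I \<Longrightarrow> a < b \<and> {a..b} \<subseteq> S) \<Longrightarrow>
       (\<And>a b c d. (a, b) \<in> I \<Longrightarrow> (c, d) \<in> I \<Longrightarrow> (a, b) \<noteq> (c, d) \<Longrightarrow> b \<le> c \<or> d \<le> a) \<Longrightarrow>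
       (\<Sum>(a, b)\<in>I. b - a) < d \<Longrightarrow> (\<Sum>(a, b)\<in>I. norm (f b - f a)) < e"
proof -
  obtain d where "0 < d" and d: "\<forall>I::(real \<times> real) set.
     finite I \<and> (\<forall>(a, b)\<in>I. a < b \<and> {a..b} \<subseteq> S) \<and>
     (\<forall>(a, b)\<in>I. \<forall>(c, d)\<in>I. (a, b) \<noteq> (c, d) \<longrightarrow> b \<le> c \<or> d \<le> a) \<and>
     (\<Sum>(a, b)\<in>I. b - a) < d \<longrightarrow> (\<Sum>(a, b)\<in>I. norm (f b - f a)) < e"
    using assms unfolding abs_cont_on_def by blast
  show thesis
  proof (rule that[OF \<open>0 < d\<close>])
    fix I :: "(real \<times> real) set"
    assume *: "finite I" "\<And>a b. (a, b) \<in> I \<Longrightarrow> a < b \<and> {a..b} \<subseteq> S"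
      "\<And>a b c d. (a, b) \<in> I \<Longrightarrow> (c, d) \<in> I \<Longrightarrow> (a, b) \<noteq> (c, d) \<Longrightarrow> b \<le> c \<or> d \<le> a"
      "(\<Sum>(a, b)\<in>I. b - a) < d"
    have "\<forall>(a, b)\<in>I. a < b \<and> {a..b} \<subseteq> S"
      using *(2) by auto
    moreover have "\<forall>(a, b)\<in>I. \<forall>(c, d)\<in>I. (a, b) \<noteq> (c, d) \<longrightarrow> b \<le> c \<or> d \<le> a"
      using *(3) by fast
    ultimately show "(\<Sum>(a, b)\<in>I. norm (f b - f a)) < e"
      using d *(1,4) by blast
  qed
qed

lemma abs_cont_on_subset: "abs_cont_on S f \<Longrightarrow> T \<subseteq> S \<Longrightarrow> abs_cont_on T f"
  unfolding abs_cont_on_def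
proof (intro allI impI)
  fix e :: real
  assume f: "\<forall>e>0. \<exists>d>0. \<forall>I::(real \<times> real) set.
       finite I \<and> (\<forall>(a, b)\<in>I. a < b \<and> {a..b} \<subseteq> S) \<and>
       (\<forall>(a, b)\<in>I. \<forall>(c, d)\<in>I. (a, b) \<noteq> (c, d) \<longrightarrow> b \<le> c \<or> d \<le> a) \<and>
       (\<Sum>(a, b)\<in>I. b - a) < d \<longrightarrow> (\<Sum>(a, b)\<in>I. norm (f b - f a)) < e"
    and "T \<subseteq> S" "0 < e"
  then have "\<And>I::(real \<times> real) set. (\<forall>(a, b)\<in>I. a < b \<and> {a..b} \<subseteq> T) \<Longrightarrow> (\<forall>(a, b)\<in>I. a < b \<and> {a..b} \<subseteq> S)"
    by fast
  then show "\<exists>d>0. \<forall>I::(real \<times> real) set.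
       finite I \<and> (\<forall>(a, b)\<in>I. a < b \<and> {a..b} \<subseteq> T) \<and>
       (\<forall>(a, b)\<in>I. \<forall>(c, d)\<in>I. (a, b) \<noteq> (c, d) \<longrightarrow> b \<le> c \<or> d \<le> a) \<and>
       (\<Sum>(a, b)\<in>I. b - a) < d \<longrightarrow> (\<Sum>(a, b)\<in>I. norm (f b - f a)) < e"
    using f \<open>0 < e\<close> by meson
qed

lemma lipschitz_on_imp_abs_cont_on:
  assumes "C-lipschitz_on S f"
  shows "abs_cont_on S f"
  unfolding abs_cont_on_def
proof (intro allI impI)
  fix e :: real
  assume "0 < e"
  have "0 \<le> C"
    using assms by (rule lipschitz_on_nonneg)
  show "\<exists>d>0. \<forall>I::(real \<times> real) set.
     finite I \<and> (\<forall>(a, b)\<in>I. a < b \<and> {a..b} \<subseteq> S) \<and>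
     (\<forall>(a, b)\<in>I. \<forall>(c, d)\<in>I. (a, b) \<noteq> (c, d) \<longrightarrow> b \<le> c \<or> d \<le> a) \<and>
     (\<Sum>(a, b)\<in>I. b - a) < d \<longrightarrow> (\<Sum>(a, b)\<in>I. norm (f b - f a)) < e"
  \<comment> \<open>The denominator is \<open>C + 1\<close> rather than \<open>C\<close> because a
    Lipschitz constant may be 0.\<close>
  proof (intro exI[of _ "e / (C + 1)"] conjI allI impI)
    show "0 < e / (C + 1)"
      using \<open>0 < e\<close> \<open>0 \<le> C\<close> by simp
    fix I :: "(real \<times> real) set"
    assume I: "finite I \<and> (\<forall>(a, b)\<in>I. a < b \<and> {a..b} \<subseteq> S) \<and>
     (\<forall>(a, b)\<in>I. \<forall>(c, d)\<in>I. (a, b) \<noteq> (c, d) \<longrightarrow> b \<le> c \<or> d \<le> a) \<and>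
     (\<Sum>(a, b)\<in>I. b - a) < e / (C + 1)"
    have "(\<Sum>(a, b)\<in>I. norm (f b - f a)) \<le> (\<Sum>(a, b)\<in>I. (C + 1) * (b - a))"
    proof (rule sum_mono, clarsimp)
      fix a b
      assume "(a, b) \<in> I"
      then have "a < b" "a \<in> S" "b \<in> S"
        using I by force+
      then have "norm (f b - f a) \<le> C * (b - a)"
        using lipschitz_onD[OF assms, of b a] by (simp add: dist_norm)
      also have "\<dots> \<le> (C + 1) * (b - a)"
        using \<open>a < b\<close> by (simp add: mult_right_mono)
      finally show "norm (f b - f a) \<le> (C + 1) * (b - a)" .
    qed
    also have "\<dots> = (C + 1) * (\<Sum>(a, b)\<in>I. b - a)"
      by (simp add: sum_distrib_left case_prod_unfold)
    also have "\<dots> < e"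
      using I \<open>0 \<le> C\<close> by (simp add: field_simps)
    finally show "(\<Sum>(a, b)\<in>I. norm (f b - f a)) < e" .
  qed
qed

text \<open>An increment of the product splits into increments of one factor, each times a bound on
  the other. Boundedness is assumed because it need not follow for unbounded \<open>S\<close>: t is
  absolutely continuous on the real line, but t * t is not.\<close>

lemma abs_cont_on_inner:
  fixes f g :: "real \<Rightarrow> 'a::real_inner"
  assumes f: "abs_cont_on S f" "bounded (f ` S)" and g: "abs_cont_on S g" "bounded (g ` S)"
  shows "abs_cont_on S (\<lambda>t. f t \<bullet> g t)"
  unfolding abs_cont_on_def
proof (intro allI impI)
  fix e :: real
  assume "0 < e"
  obtain M where M: "0 < M" "\<And>t. t \<in> S \<Longrightarrow> norm (f t) \<le> M"
    using f(2) unfolding bounded_pos by auto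
  obtain N where N: "0 < N" "\<And>t. t \<in> S \<Longrightarrow> norm (g t) \<le> N"
    using g(2) unfolding bounded_pos by auto
  have e_div: "0 < e / (2 * N)" "0 < e / (2 * M)"
    using \<open>0 < e\<close> M(1) N(1) by simp_all
  obtain d1 where d1: "0 < d1"
    "\<And>I. finite I \<Longrightarrow> (\<And>a b. (a, b) \<in> I \<Longrightarrow> a < b \<and> {a..b} \<subseteq> S) \<Longrightarrow>
       (\<And>a b c d. (a, b) \<in> I \<Longrightarrow> (c, d) \<in> I \<Longrightarrow> (a, b) \<noteq> (c, d) \<Longrightarrow> b \<le> c \<or> d \<le> a) \<Longrightarrow>
       (\<Sum>(a, b)\<in>I. b - a) < d1 \<Longrightarrow> (\<Sum>(a, b)\<in>I. norm (f b - f a)) < e / (2 * N)"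
    by (fact abs_cont_onD[OF f(1) e_div(1)])
  obtain d2 where d2: "0 < d2"
    "\<And>I. finite I \<Longrightarrow> (\<And>a b. (a, b) \<in> I \<Longrightarrow> a < b \<and> {a..b} \<subseteq> S) \<Longrightarrow>
       (\<And>a b c d. (a, b) \<in> I \<Longrightarrow> (c, d) \<in> I \<Longrightarrow> (a, b) \<noteq> (c, d) \<Longrightarrow> b \<le> c \<or> d \<le> a) \<Longrightarrow>
       (\<Sum>(a, b)\<in>I. b - a) < d2 \<Longrightarrow> (\<Sum>(a, b)\<in>I. norm (g b - g a)) < e / (2 * M)"
    by (fact abs_cont_onD[OF g(1) e_div(2)])
  show "\<exists>d>0. \<forall>I::(real \<times> real) set.
     finite I \<and> (\<forall>(a, b)\<in>I. a < b \<and> {a..b} \<subseteq> S) \<and>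
     (\<forall>(a, b)\<in>I. \<forall>(c, d)\<in>I. (a, b) \<noteq> (c, d) \<longrightarrow> b \<le> c \<or> d \<le> a) \<and>
     (\<Sum>(a, b)\<in>I. b - a) < d \<longrightarrow> (\<Sum>(a, b)\<in>I. norm (f b \<bullet> g b - f a \<bullet> g a)) < e"
  proof (intro exI[of _ "min d1 d2"] conjI allI impI)
    show "0 < min d1 d2"
      using d1 d2 by simp
    fix I :: "(real \<times> real) set"
    assume I: "finite I \<and> (\<forall>(a, b)\<in>I. a < b \<and> {a..b} \<subseteq> S) \<and>
     (\<forall>(a, b)\<in>I. \<forall>(c, d)\<in>I. (a, b) \<noteq> (c, d) \<longrightarrow> b \<le> c \<or> d \<le> a) \<and>
     (\<Sum>(a, b)\<in>I. b - a) < min d1 d2"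
    then have sep: "\<And>a b c d. (a, b) \<in> I \<Longrightarrow> (c, d) \<in> I \<Longrightarrow> (a, b) \<noteq> (c, d) \<Longrightarrow> b \<le> c \<or> d \<le> a"
      by fast
    have "(\<Sum>(a, b)\<in>I. norm (f b \<bullet> g b - f a \<bullet> g a)) \<le>
        (\<Sum>(a, b)\<in>I. N * norm (f b - f a) + M * norm (g b - g a))"
    proof (rule sum_mono, clarsimp)
      fix a b
      assume "(a, b) \<in> I"
      then have ab: "a \<in> S" "b \<in> S"
        using I by force+
      have "f b \<bullet> g b - f a \<bullet> g a = (f b - f a) \<bullet> g b + f a \<bullet> (g b - g a)"
        by (simp add: inner_diff_left inner_diff_right)
      also have "\<bar>\<dots>\<bar> \<le> norm (f b - f a) * norm (g b) + norm (f a) * norm (g b - g a)"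
        by (intro order.trans[OF abs_triangle_ineq] add_mono Cauchy_Schwarz_ineq2)
      also have "\<dots> \<le> norm (f b - f a) * N + M * norm (g b - g a)"
        by (intro add_mono mult_left_mono mult_right_mono M N ab norm_ge_zero)
      finally show "\<bar>f b \<bullet> g b - f a \<bullet> g a\<bar> \<le> N * norm (f b - f a) + M * norm (g b - g a)"
        by (simp add: mult.commute)
    qed
    also have "\<dots> = N * (\<Sum>(a, b)\<in>I. norm (f b - f a)) + M * (\<Sum>(a, b)\<in>I. norm (g b - g a))"
      by (simp add: sum_distrib_left case_prod_unfold sum.distrib)
    also have "\<dots> < N * (e / (2 * N)) + M * (e / (2 * M))"
      using I by (intro add_strict_mono mult_strict_left_mono d1 d2 sep N M) auto
    also have "\<dots> = e"
      using M(1) N(1) by simp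
    finally show "(\<Sum>(a, b)\<in>I. norm (f b \<bullet> g b - f a \<bullet> g a)) < e" .
  qed
qed

text \<open>By outer regularity, \<open>N\<close> lies in an open set whose measure is below the
  \<delta> that absolute continuity provides for \<open>e\<close>; nonoverlapping intervals inside
  that set then have total length below \<delta>. Intervals are read off through \<open>Sup\<close>
  and \<open>Inf\<close> so that the members of a tagged division can be plugged in.\<close>

lemma abs_cont_on_sum_null_intervals_less:
  fixes f :: "real \<Rightarrow> 'a::real_normed_vector"
  assumes f: "abs_cont_on S f" and N: "N \<in> null_sets lebesgue" and "0 < e"
  obtains U where "open U" "N \<subseteq> U"
    "\<And>\<D>. finite \<D> \<Longrightarrow> (\<And>K. K \<in> \<D> \<Longrightarrow> K \<subseteq> U \<inter> S \<and> (\<exists>a b. a \<le> b \<and> K = {a..b})) \<Longrightarrow>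
       pairwise (\<lambda>K L. interior K \<inter> interior L = {}) \<D> \<Longrightarrow>
       (\<Sum>K\<in>\<D>. norm (f (Sup K) - f (Inf K))) < e"
proof -
  obtain d where d: "0 < d"
    "\<And>I. finite I \<Longrightarrow> (\<And>a b. (a, b) \<in> I \<Longrightarrow> a < b \<and> {a..b} \<subseteq> S) \<Longrightarrow>
       (\<And>a b c d. (a, b) \<in> I \<Longrightarrow> (c, d) \<in> I \<Longrightarrow> (a, b) \<noteq> (c, d) \<Longrightarrow> b \<le> c \<or> d \<le> a) \<Longrightarrow>
       (\<Sum>(a, b)\<in>I. b - a) < d \<Longrightarrow> (\<Sum>(a, b)\<in>I. norm (f b - f a)) < e"
    by (fact abs_cont_onD[OF f \<open>0 < e\<close>])
  have "N \<in> sets lebesgue"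
    using N by auto
  then obtain U where U: "open U" "N \<subseteq> U" "U - N \<in> lmeasurable" "emeasure lebesgue (U - N) < ennreal d"
    using sets_lebesgue_outer_open \<open>0 < d\<close> by metis
  have "emeasure lebesgue U = emeasure lebesgue (U - N)"
    using N U by (metis emeasure_Diff_null_set borel_open lborelD sets_completionI_sets sets_lborel)
  then have emU: "emeasure lebesgue U < ennreal d"
    using U by simp
  have Ulm: "U \<in> lmeasurable"
    using emU U(1) by (intro fmeasurableI) (auto simp: less_top order.strict_trans)
  have mU: "measure lebesgue U < d"
    using emU Ulm \<open>0 < d\<close> by (simp add: emeasure_eq_measure2 ennreal_less_iff)
  show thesis
  proof (rule that[OF U(1,2)])
    fix \<D> :: "real set set"
    assume fin: "finite \<D>" and K: "\<And>K. K \<in> \<D> \<Longrightarrow> K \<subseteq> U \<inter> S \<and> (\<exists>a b. a \<le> b \<and> K = {a..b})"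
      and disj: "pairwise (\<lambda>K L. interior K \<inter> interior L = {}) \<D>"
    \<comment> \<open>Degenerate intervals are dropped because \<open>abs_cont_on\<close> speaks of
      pairs with \<open>a < b\<close>; they contribute 0 to the sum.\<close>
    define \<E> where "\<E> = {K\<in>\<D>. Inf K < Sup K}"
    have fin\<E>: "finite \<E>"
      unfolding \<E>_def using fin by simp
    have \<E>: "K = {Inf K..Sup K} \<and> Inf K < Sup K \<and> {Inf K..Sup K} \<subseteq> U \<and> {Inf K..Sup K} \<subseteq> S" if "K \<in> \<E>" for K
      using that K[of K] unfolding \<E>_def by auto
    have sep: "Sup K \<le> Inf L \<or> Sup L \<le> Inf K" if "K \<in> \<E>" "L \<in> \<E>" "K \<noteq> L" for K L
    proof -
      have "interior K \<inter> interior L = {}"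
        using disj that unfolding pairwise_def \<E>_def by auto
      moreover have "interior K = {Inf K<..<Sup K}" "interior L = {Inf L<..<Sup L}"
        using \<E>[OF that(1)] \<E>[OF that(2)] by (metis interior_atLeastAtMost_real)+
      ultimately have "{max (Inf K) (Inf L)<..<min (Sup K) (Sup L)} = {}"
        by auto
      then show ?thesis
        using \<E>[OF that(1)] \<E>[OF that(2)] by auto
    qed
    have inj: "inj_on (\<lambda>K. (Inf K, Sup K)) \<E>"
      using \<E> by (intro inj_onI) (metis Pair_inject)
    let ?I = "(\<lambda>K. (Inf K, Sup K)) ` \<E>"
    have "(\<Sum>(a, b)\<in>?I. b - a) = (\<Sum>K\<in>\<E>. measure lebesgue K)"
    proof (subst sum.reindex[OF inj], rule sum.cong[OF refl])
      fix K
      assume "K \<in> \<E>"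
      then have "K = {Inf K..Sup K}" "Inf K < Sup K"
        using \<E> by blast+
      then have "measure lebesgue K = Sup K - Inf K"
        by (metis content_real less_imp_le measure_completion measurable_completion lborelD atLeastAtMost_borel)
      then show "((\<lambda>(a, b). b - a) \<circ> (\<lambda>K. (Inf K, Sup K))) K = measure lebesgue K"
        by simp
    qed
    also have "\<dots> = measure lebesgue (\<Union>\<E>)"
    proof (rule measure_negligible_finite_Union[symmetric, OF fin\<E>])
      show "K \<in> lmeasurable" if "K \<in> \<E>" for K
        using \<E>[OF that] by (metis lmeasurable_interval(1) box_real(2) lmeasurable_cbox)
      show "pairwise (\<lambda>S T. negligible (S \<inter> T)) \<E>"
      proof (rule pairwiseI)
        fix K L
        assume "K \<in> \<E>" "L \<in> \<E>" "K \<noteq> L"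
        then have "{Inf K..Sup K} \<inter> {Inf L..Sup L} \<subseteq> {Sup K, Sup L}"
          using sep[of K L] by auto
        then have "K \<inter> L \<subseteq> {Sup K, Sup L}"
          using \<E>[OF \<open>K \<in> \<E>\<close>] \<E>[OF \<open>L \<in> \<E>\<close>] by metis
        then show "negligible (K \<inter> L)"
          by (meson finite.emptyI finite.insertI negligible_finite negligible_subset)
      qed
    qed
    also have "\<dots> \<le> measure lebesgue U"
    proof (rule measure_mono_fmeasurable[OF _ _ Ulm])
      show "\<Union>\<E> \<subseteq> U"
        using \<E> by blast
      have "closed (\<Union>\<E>)"
        using fin\<E> \<E> by (intro closed_Union) (metis closed_atLeastAtMost)+
      then show "\<Union>\<E> \<in> sets lebesgue"
        by simp
    qed
    also have "\<dots> < d"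
      by (rule mU)
    finally have small: "(\<Sum>(a, b)\<in>?I. b - a) < d" .
    have "(\<Sum>(a, b)\<in>?I. norm (f b - f a)) < e"
    proof (rule d(2)[OF _ _ _ small])
      show "finite ?I"
        using fin\<E> by simp
      show "a < b \<and> {a..b} \<subseteq> S" if "(a, b) \<in> ?I" for a b
        using that \<E> by blast
      show "b \<le> a' \<or> b' \<le> a" if "(a, b) \<in> ?I" "(a', b') \<in> ?I" "(a, b) \<noteq> (a', b')" for a b a' b'
        using that sep by blast
    qed
    moreover have "(\<Sum>(a, b)\<in>?I. norm (f b - f a)) = (\<Sum>K\<in>\<E>. norm (f (Sup K) - f (Inf K)))"
      by (simp add: sum.reindex[OF inj])
    moreover have "(\<Sum>K\<in>\<E>. norm (f (Sup K) - f (Inf K))) = (\<Sum>K\<in>\<D>. norm (f (Sup K) - f (Inf K)))"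
    proof (rule sum.mono_neutral_left[OF fin])
      show "\<E> \<subseteq> \<D>"
        unfolding \<E>_def by auto
      have "Sup K = Inf K" if "K \<in> \<D> - \<E>" for K
        using that K[of K] unfolding \<E>_def by auto
      then show "\<forall>K\<in>\<D> - \<E>. norm (f (Sup K) - f (Inf K)) = 0"
        by simp
    qed
    ultimately show "(\<Sum>K\<in>\<D>. norm (f (Sup K) - f (Inf K))) < e"
      by simp
  qed
qed

text \<open>A gauge argument: near a tag outside the null set the derivative bounds the increment,
  the tags inside it are handled by \<open>abs_cont_on_sum_null_intervals_less\<close>, and the
  increments over a fine tagged division telescope. Continuity alone would not do, as the Cantor
  function shows.\<close>

lemma abs_cont_on_deriv_nonpos_imp_decreasing:
  fixes f :: "real \<Rightarrow> real"
  assumes ac: "abs_cont_on {a..b} f" and "a \<le> b"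
    and deriv: "AE t in lebesgue. t \<in> {a..b} \<longrightarrow>
        (\<exists>D\<le>0. (f has_real_derivative D) (at t within {a..b}))"
  shows "f b \<le> f a"
proof -
  obtain N where good: "\<And>t. t \<in> {a..b} - N \<Longrightarrow> \<exists>D\<le>0. (f has_real_derivative D) (at t within {a..b})"
    and N: "N \<in> null_sets lebesgue"
  proof (rule AE_E3[OF deriv])
    fix N
    assume "\<And>t. t \<in> space lebesgue - N \<Longrightarrow> t \<in> {a..b} \<longrightarrow> (\<exists>D\<le>0. (f has_real_derivative D) (at t within {a..b}))"
      and "N \<in> null_sets lebesgue"
    then show thesis
      using that[of N] by simp
  qed
  \<comment> \<open>The part \<open>e * (b - a)\<close> pays for the tags outside \<open>N\<close>,
    the extra \<open>e\<close> for those in \<open>N\<close>.\<close>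
  have "f b - f a \<le> e * (b - a + 1)" if "0 < e" for e
  proof -
    obtain U where U: "open U" "N \<subseteq> U"
      "\<And>\<D>. finite \<D> \<Longrightarrow> (\<And>K. K \<in> \<D> \<Longrightarrow> K \<subseteq> U \<inter> {a..b} \<and> (\<exists>a b. a \<le> b \<and> K = {a..b})) \<Longrightarrow>
         pairwise (\<lambda>K L. interior K \<inter> interior L = {}) \<D> \<Longrightarrow>
         (\<Sum>K\<in>\<D>. norm (f (Sup K) - f (Inf K))) < e"
      by (fact abs_cont_on_sum_null_intervals_less[OF ac N \<open>0 < e\<close>])
    have "\<exists>r>0. (t \<in> N \<longrightarrow> ball t r \<subseteq> U) \<and> (t \<in> {a..b} - N \<longrightarrow>
        (\<forall>u v. u \<in> {a..b} \<longrightarrow> v \<in> {a..b} \<longrightarrow> u \<le> t \<longrightarrow> t \<le> v \<longrightarrow> {u..v} \<subseteq> ball t r \<longrightarrow> f v - f u \<le> e * (v - u)))" for t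
    proof (cases "t \<in> N")
      case True
      then show ?thesis
        using U(1,2) open_contains_ball by blast
    next
      case False
      show ?thesis
      proof (cases "t \<in> {a..b}")
        case True
        with False obtain D where D: "D \<le> 0" "(f has_real_derivative D) (at t within {a..b})"
          using good by blast
        then obtain r where r: "r > 0" "\<And>y. y \<in> {a..b} \<Longrightarrow> norm (y - t) < r \<Longrightarrow>
            norm (f y - f t - D * (y - t)) \<le> e * norm (y - t)"
          using \<open>0 < e\<close> unfolding has_field_derivative_def has_derivative_within_alt by blast
        have "f v - f u \<le> e * (v - u)" if uv: "u \<in> {a..b}" "v \<in> {a..b}" "u \<le> t" "t \<le> v" "{u..v} \<subseteq> ball t r" for u v
        proof -
          have "u \<in> {u..v}" "v \<in> {u..v}"
            using uv by auto
          then have "u \<in> ball t r" "v \<in> ball t r"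
            using uv(5) by blast+
          then have "\<bar>f v - f t - D * (v - t)\<bar> \<le> e * (v - t)" "\<bar>f u - f t - D * (u - t)\<bar> \<le> e * (t - u)"
            using r(2)[of u] r(2)[of v] uv by (auto simp: dist_norm)
          \<comment> \<open>Since the tag lies between \<open>u\<close> and \<open>v\<close>, the
            linear terms on both sides only lower the increment; the two errors add up to at most
            \<open>e * (v - u)\<close>.\<close>
          moreover have "D * (v - t) \<le> 0" "0 \<le> D * (u - t)"
            using D(1) uv by (auto simp: mult_nonpos_nonneg mult_nonpos_nonpos)
          ultimately show ?thesis
            by (simp add: algebra_simps)
        qed
        then show ?thesis
          using r(1) False by blast
      qed (use False in \<open>auto intro: exI[of _ 1]\<close>)
    qed
    then obtain r where r: "\<And>t. 0 < r t" "\<And>t. t \<in> N \<Longrightarrow> ball t (r t) \<subseteq> U"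
      "\<And>t u v. t \<in> {a..b} - N \<Longrightarrow> u \<in> {a..b} \<Longrightarrow> v \<in> {a..b} \<Longrightarrow> u \<le> t \<Longrightarrow> t \<le> v \<Longrightarrow>
         {u..v} \<subseteq> ball t (r t) \<Longrightarrow> f v - f u \<le> e * (v - u)"
      by metis
    have "gauge (\<lambda>t. ball t (r t))"
      using r(1) by (intro gaugeI) auto
    then obtain p where p: "p tagged_division_of {a..b}" "(\<lambda>t. ball t (r t)) fine p"
      using fine_division_exists_real by blast
    note pD = tagged_division_ofD[OF p(1)]
    have K: "\<exists>u v. K = {u..v} \<and> u \<le> t \<and> t \<le> v \<and> u \<in> {a..b} \<and> v \<in> {a..b} \<and> {u..v} \<subseteq> ball t (r t)"
      if tK: "(t, K) \<in> p" for t K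
    proof -
      obtain u v where "K = {u..v}"
        using pD(4)[OF tK] by (auto simp: box_real)
      then show ?thesis
        using pD(2,3)[OF tK] fineD[OF p(2) tK] by (intro exI[of _ u] exI[of _ v]) auto
    qed
    define q where "q = {x\<in>p. fst x \<in> N}"
    have qp: "q \<subseteq> p" "finite p"
      unfolding q_def using pD(1) by auto
    \<comment> \<open>The tags in \<open>N\<close> need not cover \<open>{a..b}\<close>, but they do
      divide the union of their own intervals. This is enough to pass from a sum over tags to a sum
      over intervals.\<close>
    have q: "q tagged_division_of \<Union>(snd ` q)"
      using p(1) qp(1) unfolding tagged_division_of_def[of p]
      by (metis tagged_partial_division_of_Union_self tagged_partial_division_subset)
    have "f b - f a = (\<Sum>(x, K)\<in>p. f (Sup K) - f (Inf K))"
      by (rule additive_tagged_division_1[OF \<open>a \<le> b\<close> p(1), symmetric])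
    also have "\<dots> = (\<Sum>(x, K)\<in>p - q. f (Sup K) - f (Inf K)) + (\<Sum>(x, K)\<in>q. f (Sup K) - f (Inf K))"
      using qp by (rule sum.subset_diff)
    finally have split: "f b - f a =
        (\<Sum>(x, K)\<in>p - q. f (Sup K) - f (Inf K)) + (\<Sum>(x, K)\<in>q. f (Sup K) - f (Inf K))" .
    have good_le: "(\<Sum>(x, K)\<in>p - q. f (Sup K) - f (Inf K)) \<le> e * (b - a)"
    proof -
      have "(\<Sum>(x, K)\<in>p - q. f (Sup K) - f (Inf K)) \<le> (\<Sum>(x, K)\<in>p - q. e * (Sup K - Inf K))"
      proof (rule sum_mono, clarsimp)
        fix t K
        assume tK: "(t, K) \<in> p" "(t, K) \<notin> q"
        have "t \<in> {a..b} - N"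
          using tK pD(2,3)[OF tK(1)] unfolding q_def by auto
        obtain u v where uv: "K = {u..v}" "u \<le> t" "t \<le> v" "u \<in> {a..b}" "v \<in> {a..b}" "{u..v} \<subseteq> ball t (r t)"
          using K[OF tK(1)] by blast
        show "f (Sup K) - f (Inf K) \<le> e * (Sup K - Inf K)"
          using r(3)[OF \<open>t \<in> {a..b} - N\<close> uv(4,5,2,3,6)] uv by simp
      qed
      also have "\<dots> \<le> (\<Sum>(x, K)\<in>p. e * (Sup K - Inf K))"
      proof (rule sum_mono2)
        fix x
        assume "x \<in> p - (p - q)"
        then obtain t K u v where "x = (t, K)" "K = {u..v}" "u \<le> t" "t \<le> v"
          using K by (metis DiffD1 surj_pair)
        then show "0 \<le> (case x of (x, K) \<Rightarrow> e * (Sup K - Inf K))"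
          using \<open>0 < e\<close> by simp
      qed (use qp in auto)
      also have "\<dots> = e * (\<Sum>(x, K)\<in>p. Sup K - Inf K)"
        by (simp add: sum_distrib_left case_prod_unfold)
      also have "\<dots> = e * (b - a)"
        using additive_tagged_division_1[OF \<open>a \<le> b\<close> p(1), of "\<lambda>x. x"] by simp
      finally show ?thesis .
    qed
    have null_le: "(\<Sum>(x, K)\<in>q. f (Sup K) - f (Inf K)) \<le> e"
    proof -
      \<comment> \<open>The case distinction shields against the unspecified \<open>Sup {}\<close> and \<open>Inf {}\<close>.\<close>
      define d where "d K = (if K = {} then 0 else f (Sup K) - f (Inf K))" for K
      have "(\<Sum>(x, K)\<in>q. f (Sup K) - f (Inf K)) = (\<Sum>(x, K)\<in>q. d K)"
      proof (rule sum.cong[OF refl], clarify)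
        fix t K
        assume "(t, K) \<in> q"
        then have "K \<noteq> {}"
          using tagged_division_ofD(2)[OF q] by blast
        then show "f (Sup K) - f (Inf K) = d K"
          by (simp add: d_def)
      qed
      \<comment> \<open>An interval that carries two tags has empty interior, and \<open>d\<close>
        vanishes on it.\<close>
      also have "\<dots> = (\<Sum>K\<in>snd ` q. d K)"
        by (rule sum.over_tagged_division_lemma[OF q]) (auto simp: box_real d_def)
      also have "\<dots> \<le> (\<Sum>K\<in>snd ` q. norm (f (Sup K) - f (Inf K)))"
        unfolding d_def by (rule sum_mono) auto
      also have "\<dots> < e"
      proof (rule U(3))
        show "finite (snd ` q)"
          using qp finite_subset by blast
        show "K \<subseteq> U \<inter> {a..b} \<and> (\<exists>a b. a \<le> b \<and> K = {a..b})" if Kq: "K \<in> snd ` q" for K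
        proof -
          obtain t where t: "(t, K) \<in> p" "t \<in> N"
            using Kq unfolding q_def by auto
          obtain u v where uv: "K = {u..v}" "u \<le> t" "t \<le> v" "{u..v} \<subseteq> ball t (r t)"
            using K[OF t(1)] by blast
          then have "u \<le> v"
            by simp
          then show ?thesis
            using uv r(2)[OF t(2)] pD(3)[OF t(1)] by blast
        qed
        show "pairwise (\<lambda>K L. interior K \<inter> interior L = {}) (snd ` q)"
        proof (rule pairwiseI)
          fix K L
          assume "K \<in> snd ` q" "L \<in> snd ` q" and "K \<noteq> L"
          then obtain t u where "(t, K) \<in> q" "(u, L) \<in> q"
            by (metis imageE prod.collapse)
          then show "interior K \<inter> interior L = {}"
            using tagged_division_ofD(5)[OF q] \<open>K \<noteq> L\<close> by blast
        qed
      qed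
      finally show ?thesis by simp
    qed
    show ?thesis
      using split good_le null_le by (simp add: algebra_simps)
  qed
  from this[of "e / (b - a + 1)" for e] have "f b - f a \<le> 0 + e" if "0 < e" for e
    using that \<open>a \<le> b\<close> by simp
  then show ?thesis
    using field_le_epsilon[of "f b - f a" 0] by simp
qed

text \<open>The solution is the exponential series of t B applied to \<open>v0\<close>. Each of its
  components is a scalar power series that converges everywhere, so it may be differentiated
  termwise.\<close>

lemma linear_flow_exists:
  fixes B :: "'a::euclidean_space \<Rightarrow> 'a"
  assumes "bounded_linear B"
  obtains v where "v 0 = v0" "\<And>t. (v has_vector_derivative B (v t)) (at t)"
proof -
  interpret B: bounded_linear B by fact
  obtain K where K: "K > 0" "\<And>x. norm (B x) \<le> norm x * K"
    using B.pos_bounded by blast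
  define w where "w k = (B ^^ k) v0" for k
  have w0: "w 0 = v0" and wSuc: "w (Suc k) = B (w k)" for k
    unfolding w_def by simp_all
  have norm_w: "norm (w k) \<le> norm v0 * K ^ k" for k
  proof (induction k)
    case (Suc k)
    then show ?case
      using order.trans[OF K(2)[of "w k"] mult_right_mono[OF Suc, of K]] K(1) by (simp add: wSuc mult_ac)
  qed (simp add: w0)
  have summable: "summable (\<lambda>k. (t ^ k / fact k) *\<^sub>R w k)" for t :: real
  proof (rule summable_comparison_test')
    show "summable (\<lambda>k. norm v0 * (inverse (fact k) * (\<bar>t\<bar> * K) ^ k))"
      using summable_exp[of "\<bar>t\<bar> * K"] by (rule summable_mult)
    show "norm ((t ^ k / fact k) *\<^sub>R w k) \<le> norm v0 * (inverse (fact k) * (\<bar>t\<bar> * K) ^ k)" for k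
    proof -
      have "norm ((t ^ k / fact k) *\<^sub>R w k) = \<bar>t\<bar> ^ k / fact k * norm (w k)"
        by (simp add: power_abs)
      also have "\<dots> \<le> \<bar>t\<bar> ^ k / fact k * (norm v0 * K ^ k)"
        by (intro mult_left_mono norm_w) simp
      finally show ?thesis
        by (simp add: power_mult_distrib divide_inverse mult_ac)
    qed
  qed
  define v where "v t = (\<Sum>k. (t ^ k / fact k) *\<^sub>R w k)" for t :: real
  have inner_v: "v t \<bullet> b = (\<Sum>k. (w k \<bullet> b / fact k) * t ^ k)" for t b
    unfolding v_def
    by (subst bounded_linear.suminf[OF bounded_linear_inner_left summable]) (simp add: mult_ac)
  have inner_summable: "summable (\<lambda>k. (w k \<bullet> b / fact k) * t ^ k)" for t b
    using bounded_linear.summable[OF bounded_linear_inner_left summable, of t b] by (simp add: mult_ac)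
  have B_v: "B (v t) = (\<Sum>k. (t ^ k / fact k) *\<^sub>R w (Suc k))" for t
    unfolding v_def
    by (subst B.suminf[OF summable]) (simp add: B.scaleR wSuc)
  \<comment> \<open>\<open>diffs\<close> shifts the coefficients and multiplies by
    \<open>k + 1\<close>, which turns the factorial of \<open>k + 1\<close> into that of
    \<open>k\<close> and leaves \<open>w (Suc k)\<close>.\<close>
  have inner_B_v: "B (v t) \<bullet> b = (\<Sum>k. diffs (\<lambda>k. w k \<bullet> b / fact k) k * t ^ k)" for t b
  proof -
    have "summable (\<lambda>k. (t ^ k / fact k) *\<^sub>R w (Suc k))"
      using B.summable[OF summable[of t]] by (simp add: B.scaleR wSuc)
    then show ?thesis
      unfolding B_v
      by (subst bounded_linear.suminf[OF bounded_linear_inner_left])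
        (simp_all add: diffs_def mult_ac del: of_nat_Suc)
  qed
  have "(v has_vector_derivative B (v t)) (at t)" for t
    unfolding has_vector_derivative_def
  proof (subst has_derivative_componentwise_within, intro ballI)
    fix b :: 'a
    have "((\<lambda>t. v t \<bullet> b) has_real_derivative B (v t) \<bullet> b) (at t)"
      unfolding inner_v inner_B_v using inner_summable by (rule termdiffs_strong_converges_everywhere)
    then show "((\<lambda>t. v t \<bullet> b) has_derivative (\<lambda>h. h *\<^sub>R B (v t) \<bullet> b)) (at t)"
      by (simp add: has_field_derivative_def mult_commute_abs)
  qed
  moreover have "v 0 = v0"
  proof -
    have "v 0 = (\<Sum>k\<in>{0}. (0 ^ k / fact k) *\<^sub>R w k)"
      unfolding v_def by (rule suminf_finite) auto
    then show ?thesis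
      by (simp add: w0)
  qed
  ultimately show thesis
    using that by blast
qed

section \<open>The costate of a diagonal system\<close>

text \<open>Because \<open>v\<close> sums to zero, subtracting a constant from \<open>q\<close> does
  not change the sum. If the constant is the least \<open>q\<close> over the indices with
  \<open>0 \<le> v j\<close>, every term becomes nonnegative.\<close>

lemma single_crossing_sum_nonneg:
  fixes v q :: "'n::finite \<Rightarrow> real"
  assumes sum0: "(\<Sum>j\<in>UNIV. v j) = 0"
    and cross: "\<And>j k. 0 \<le> v j \<Longrightarrow> v k < 0 \<Longrightarrow> q k \<le> q j"
  shows "0 \<le> (\<Sum>j\<in>UNIV. v j * q j)"
proof -
  have "{j. 0 \<le> v j} \<noteq> {}"
  proof
    assume "{j. 0 \<le> v j} = {}"
    then have "(\<Sum>j\<in>UNIV. v j) < (\<Sum>j\<in>(UNIV::'n set). 0)"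
      by (intro sum_strict_mono) (auto simp: not_le)
    with sum0 show False by simp
  qed
  then obtain i where i: "0 \<le> v i" "\<And>j. 0 \<le> v j \<Longrightarrow> q i \<le> q j"
    using arg_min_if_finite[of "{j. 0 \<le> v j}" q] by (auto simp: not_less)
  have "0 \<le> (\<Sum>j\<in>UNIV. v j * (q j - q i))"
  proof (rule sum_nonneg)
    show "0 \<le> v j * (q j - q i)" for j
      using i cross[of i j] by (cases "0 \<le> v j") (auto simp: mult_nonpos_nonpos)
  qed
  also have "\<dots> = (\<Sum>j\<in>UNIV. v j * q j) - (\<Sum>j\<in>UNIV. v j) * q i"
    by (simp add: right_diff_distrib sum_subtractf sum_distrib_right)
  finally show ?thesis
    using sum0 by simp
qed

text \<open>A nonzero vector of sum zero has a negative entry, and the finitely many strict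
  inequalities at its index leave a common margin.\<close>

lemma single_crossing_sum_pos:
  fixes v q :: "'n::finite \<Rightarrow> real"
  assumes sum0: "(\<Sum>j\<in>UNIV. v j) = 0" and "v i \<noteq> 0"
    and cross: "\<And>j k. 0 \<le> v j \<Longrightarrow> v k < 0 \<Longrightarrow> q k < q j"
  shows "0 < (\<Sum>j\<in>UNIV. v j * q j)"
proof -
  obtain k where k: "v k < 0"
  proof (rule ccontr)
    assume "\<not> thesis"
    then have "\<And>k. 0 \<le> v k"
      using that not_less by blast
    then have "v i = 0"
      using sum0 by (simp add: sum_nonneg_eq_0_iff)
    with \<open>v i \<noteq> 0\<close> show False ..
  qed
  obtain e where e: "0 < e" "\<And>j. 0 \<le> v j \<Longrightarrow> q k + e \<le> q j"
  proof (cases "{j. 0 \<le> v j} = {}")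
    case True
    then show thesis using that[of 1] by auto
  next
    case False
    then obtain l where "0 \<le> v l" "\<And>j. 0 \<le> v j \<Longrightarrow> q l \<le> q j"
      using arg_min_if_finite[of "{j. 0 \<le> v j}" q] by (auto simp: not_less)
    then show thesis
      using that[of "q l - q k"] cross[of l k] k by auto
  qed
  \<comment> \<open>Raising \<open>q k\<close> by \<open>e\<close> preserves the crossing condition but strictly lowers the sum.\<close>
  have "0 \<le> (\<Sum>j\<in>UNIV. v j * (q j + (if j = k then e else 0)))"
    using e k cross by (intro single_crossing_sum_nonneg[OF sum0]) (auto intro: less_imp_le)
  also have "\<dots> = (\<Sum>j\<in>UNIV. v j * q j) + (\<Sum>j\<in>UNIV. if j = k then v j * e else 0)"
    unfolding sum.distrib[symmetric] by (rule sum.cong) (auto simp: distrib_left)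
  also have "\<dots> = (\<Sum>j\<in>UNIV. v j * q j) + v k * e"
    by simp
  finally show ?thesis
    using mult_neg_pos[OF k e(1)] by linarith
qed

text \<open>This is the coefficient of diag(a) \<open>w\<close> along the all-ones vector.
  Subtracting it from every entry projects diag(a) \<open>w\<close> orthogonally onto the sum-zero
  vectors.\<close>

definition weighted_mean :: "real^'n \<Rightarrow> real^'n \<Rightarrow> real" where
  "weighted_mean a w = (\<Sum>i\<in>UNIV. a $ i * w $ i) / real CARD('n)"

text \<open>The initial vector is \<open>a\<close> projected onto the sum-zero vectors, so its inner
  product with \<open>v t\<close> is the dimension times \<open>weighted_mean a (v t)\<close>;
  symmetry of the flow makes that product a square. The gap \<open>a $ k - a $ j\<close> in the last
  clause is a difference of entries at time 0; keeping it excludes \<open>v t = 0\<close> later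
  unless \<open>a\<close> is constant.\<close>

lemma centered_flow_exists:
  fixes a :: "real^'n"
  obtains v :: "real \<Rightarrow> real^'n" where
    "\<And>t. (v has_vector_derivative (\<chi> j. a $ j * v t $ j - weighted_mean a (v t))) (at t)"
    "\<And>t. (\<Sum>j\<in>UNIV. v t $ j) = 0"
    "\<And>t. 0 \<le> weighted_mean a (v t)"
    "\<And>j. v 0 $ j = a $ j - (\<Sum>i\<in>UNIV. a $ i) / real CARD('n)"
    "\<And>t j k. 0 \<le> t \<Longrightarrow> a $ j \<le> a $ k \<Longrightarrow> 
       exp (- a $ j * t) * v t $ j + (a $ k - a $ j) \<le> exp (- a $ k * t) * v t $ k"
proof -
  define B :: "real^'n \<Rightarrow> real^'n" where "B w = (\<chi> j. a $ j * w $ j - weighted_mean a w)" for w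
  define mean where "mean = (\<Sum>i\<in>UNIV. a $ i) / real CARD('n)"
  have "linear B"
    unfolding B_def weighted_mean_def
    by (rule linearI) (simp_all add: vec_eq_iff algebra_simps sum.distrib add_divide_distrib
        sum_distrib_left sum_divide_distrib)
  then have "bounded_linear B"
    by (simp add: linear_conv_bounded_linear)
  then obtain v where v0: "v 0 = (\<chi> j. a $ j - mean)"
    and deriv: "\<And>t. (v has_vector_derivative B (v t)) (at t)"
    using linear_flow_exists by metis
  have deriv_nth: "((\<lambda>t. v t $ j) has_real_derivative a $ j * v t $ j - weighted_mean a (v t)) (at t)" for t j
    using bounded_linear.has_vector_derivative[OF bounded_linear_vec_nth deriv[of t], of j]
    by (simp add: B_def has_real_derivative_iff_has_vector_derivative)
  have sum0: "(\<Sum>j\<in>UNIV. v t $ j) = 0" for t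
  proof -
    have "((\<lambda>t. \<Sum>j\<in>UNIV. v t $ j) has_real_derivative 0) (at t)" for t
      by (rule derivative_eq_intros deriv_nth refl)+ (simp add: sum_subtractf weighted_mean_def)
    then have "(\<Sum>j\<in>UNIV. v t $ j) = (\<Sum>j\<in>UNIV. v 0 $ j)"
      by (intro DERIV_isconst_all) auto
    also have "\<dots> = 0"
      by (simp add: v0 sum_subtractf mean_def)
    finally show ?thesis .
  qed
  \<comment> \<open>The constant correction is orthogonal to sum-zero vectors. Only the diagonal
    part survives, and it is symmetric in the two arguments.\<close>
  have inner_B: "B (v t) \<bullet> v s = (\<Sum>j\<in>UNIV. a $ j * v t $ j * v s $ j)" for t s
  proof -
    have "B (v t) \<bullet> v s = (\<Sum>j\<in>UNIV. a $ j * v t $ j * v s $ j) - weighted_mean a (v t) * (\<Sum>j\<in>UNIV. v s $ j)"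
      by (simp add: inner_vec_def B_def left_diff_distrib sum_subtractf sum_distrib_left)
    then show ?thesis
      by (simp add: sum0)
  qed
  \<comment> \<open>\<open>B\<close> is symmetric on the sum-zero vectors, so \<open>v t \<bullet> v 0\<close> is a square.\<close>
  have M_nonneg: "0 \<le> weighted_mean a (v t)" for t
  proof -
    have "((\<lambda>s. v (t - s) \<bullet> v s) has_real_derivative 0) (at s)" for s
    proof -
      have "((\<lambda>s. v (t - s)) has_vector_derivative (- 1) *\<^sub>R B (v (t - s))) (at s)"
      proof -
        have "((\<lambda>s. t - s) has_vector_derivative - 1) (at s)"
          by (auto intro!: derivative_eq_intros)
        from vector_diff_chain_at[OF this deriv] show ?thesis
          by (simp add: o_def)
      qed
      from bounded_bilinear.has_vector_derivative[OF bounded_bilinear_inner this deriv[of s]]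
      show ?thesis
        unfolding has_real_derivative_iff_has_vector_derivative
        using inner_B[of s "t - s"] inner_B[of "t - s" s] by (simp add: inner_commute mult_ac)
    qed
    \<comment> \<open>The constant function of \<open>s\<close> is compared at 0 and at the
      midpoint, where both factors coincide.\<close>
    then have "v (t - 0) \<bullet> v 0 = v (t - t/2) \<bullet> v (t/2)"
      by (intro DERIV_isconst_all) auto
    then have "0 \<le> v t \<bullet> v 0"
      by simp
    also have "v t \<bullet> v 0 = (\<Sum>j\<in>UNIV. a $ j * v t $ j) - mean * (\<Sum>j\<in>UNIV. v t $ j)"
      by (simp add: inner_vec_def v0 right_diff_distrib sum_subtractf sum_distrib_left mult_ac)
    finally show ?thesis
      by (simp add: sum0 weighted_mean_def)
  qed
  have mono: "exp (- a $ j * t) * v t $ j + (a $ k - a $ j) \<le> exp (- a $ k * t) * v t $ k"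
    if "0 \<le> t" "a $ j \<le> a $ k" for t j k
  proof -
    define D where "D s = exp (- a $ k * s) * v s $ k - exp (- a $ j * s) * v s $ j" for s :: real
    \<comment> \<open>The exponentials are integrating factors: they remove the diagonal terms and
      leave the common mean, weighted by exponentials of which the one with the larger rate is the
      smaller for \<open>0 \<le> s\<close>.\<close>
    have D: "(D has_real_derivative weighted_mean a (v s) * (exp (- a $ j * s) - exp (- a $ k * s))) (at s)" for s
      unfolding D_def
      by (rule derivative_eq_intros deriv_nth refl)+ (simp add: algebra_simps)
    have "D 0 \<le> D t"
    proof (rule DERIV_nonneg_imp_nondecreasing[OF \<open>0 \<le> t\<close>])
      fix s :: real
      assume "0 \<le> s"
      then have "0 \<le> weighted_mean a (v s) * (exp (- a $ j * s) - exp (- a $ k * s))"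
        using M_nonneg that(2) by (intro mult_nonneg_nonneg) (auto intro: mult_right_mono)
      then show "\<exists>y. (D has_real_derivative y) (at s) \<and> 0 \<le> y"
        using D by blast
    qed
    then show ?thesis
      by (simp add: D_def v0)
  qed
  show thesis
    by (rule that[OF deriv[unfolded B_def] sum0 M_nonneg _ mono]) (simp_all add: v0 mean_def)
qed

text \<open>Pair the costate with the centered flow started at \<open>t0\<close>: the inner product
  does not increase up to \<open>T\<close>, where it is positive. Expanding its value at
  \<open>t0\<close> gives the inequality, which at a zero of the switching function reads
  \<open>0 < (\<Sum>j\<in>UNIV. a $ j * lam t0 $ j)\<close>.\<close>

lemma centered_costate_pos:
  fixes a :: "real^'n" and lam :: "real \<Rightarrow> real^'n" and P :: "real \<Rightarrow> real^'n"
  assumes t0: "t0 \<in> {0..T}" and ac: "abs_cont_on {0..T} lam" and cont: "continuous_on {0..T} lam"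
    and dyn: "AE t in lebesgue. t \<in> {0..T} \<longrightarrow>
      (lam has_vector_derivative (\<chi> j. P t $ j - a $ j * lam t $ j)) (at t within {0..T}) \<and>
      0 \<le> (\<Sum>j\<in>UNIV. lam t $ j) \<and>
      (\<forall>j k. lam T $ j \<le> lam T $ k \<longrightarrow> P t $ k \<le> P t $ j)"
    and order: "\<And>j k. lam T $ j \<le> lam T $ k \<Longrightarrow> a $ j \<le> a $ k"
    and strict: "a $ j2 < a $ j1"
  shows "(\<Sum>i\<in>UNIV. a $ i) / real CARD('n) * (\<Sum>j\<in>UNIV. lam t0 $ j) < (\<Sum>j\<in>UNIV. a $ j * lam t0 $ j)"
proof -
  obtain v :: "real \<Rightarrow> real^'n" where
    v_deriv: "\<And>t. (v has_vector_derivative (\<chi> j. a $ j * v t $ j - weighted_mean a (v t))) (at t)" and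
    v_sum: "\<And>t. (\<Sum>j\<in>UNIV. v t $ j) = 0" and
    v_M: "\<And>t. 0 \<le> weighted_mean a (v t)" and
    v_0: "\<And>j. v 0 $ j = a $ j - (\<Sum>i\<in>UNIV. a $ i) / real CARD('n)" and
    v_mono: "\<And>t j k. 0 \<le> t \<Longrightarrow> a $ j \<le> a $ k \<Longrightarrow>
       exp (- a $ j * t) * v t $ j + (a $ k - a $ j) \<le> exp (- a $ k * t) * v t $ k"
    by (fact centered_flow_exists)
  \<comment> \<open>The order of \<open>lam T\<close> passes to \<open>a\<close> and from there to
    the rescaled entries of \<open>v t\<close>. Rescaling preserves signs, so a nonnegative entry
    cannot rank at or below a negative one.\<close>
  have cross: "lam T $ k < lam T $ j" if "0 \<le> t" "0 \<le> v t $ j" "v t $ k < 0" for t j k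
  proof (rule ccontr)
    assume "\<not> lam T $ k < lam T $ j"
    then have "a $ j \<le> a $ k"
      using order by simp
    then have "0 \<le> exp (- a $ k * t) * v t $ k"
      using v_mono[OF \<open>0 \<le> t\<close>, of j k] \<open>0 \<le> v t $ j\<close> by (smt (verit) exp_gt_zero mult_nonneg_nonneg)
    with \<open>v t $ k < 0\<close> show False
      by (simp add: zero_le_mult_iff)
  qed
  define G where "G t = v (t - t0) \<bullet> lam t" for t
  have v_shift: "((\<lambda>t. v (t - t0)) has_vector_derivative (\<chi> j. a $ j * v (t - t0) $ j - weighted_mean a (v (t - t0)))) (at t within S)" for t S
  proof -
    have "((\<lambda>t. t - t0) has_vector_derivative 1) (at t)"
      by (auto intro!: derivative_eq_intros)
    from vector_diff_chain_at[OF this v_deriv] show ?thesis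
      by (auto simp: o_def intro: has_vector_derivative_at_within)
  qed
  have v_cont: "continuous_on S (\<lambda>t. v (t - t0))" for S
    using v_shift by (meson continuous_on_eq_continuous_within has_vector_derivative_continuous)
  have "G T \<le> G t0"
  proof (rule abs_cont_on_deriv_nonpos_imp_decreasing[where f = G])
    show "t0 \<le> T"
      using t0 by simp
    show "abs_cont_on {t0..T} G"
      unfolding G_def
    proof (rule abs_cont_on_inner)
      show "abs_cont_on {t0..T} lam"
        using t0 by (intro abs_cont_on_subset[OF ac]) auto
      have "continuous_on {t0..T} lam"
        using t0 by (intro continuous_on_subset[OF cont]) auto
      then show "bounded (lam ` {t0..T})"
        by (intro compact_imp_bounded compact_continuous_image) auto
      show "bounded ((\<lambda>t. v (t - t0)) ` {t0..T})"
        by (intro compact_imp_bounded compact_continuous_image v_cont) auto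
      have "continuous_on {t0..T} (\<lambda>t. \<chi> j. a $ j * v (t - t0) $ j - weighted_mean a (v (t - t0)))"
        unfolding weighted_mean_def by (intro continuous_intros v_cont) auto
      then have "bounded ((\<lambda>t. \<chi> j. a $ j * v (t - t0) $ j - weighted_mean a (v (t - t0))) ` {t0..T})"
        by (intro compact_imp_bounded compact_continuous_image) auto
      then obtain C where C: "0 < C" "\<And>t. t \<in> {t0..T} \<Longrightarrow> norm (\<chi> j. a $ j * v (t - t0) $ j - weighted_mean a (v (t - t0))) \<le> C"
        unfolding bounded_pos by auto
      have "C-lipschitz_on {t0..T} (\<lambda>t. v (t - t0))"
      proof (rule bounded_derivative_imp_lipschitz
          [where f' = "\<lambda>t h. h *\<^sub>R (\<chi> j. a $ j * v (t - t0) $ j - weighted_mean a (v (t - t0)))"])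
        show "((\<lambda>t. v (t - t0)) has_derivative (\<lambda>h. h *\<^sub>R (\<chi> j. a $ j * v (t - t0) $ j - weighted_mean a (v (t - t0))))) (at t within {t0..T})" for t
          using v_shift[of t "{t0..T}"] unfolding has_vector_derivative_def .
        show "onorm (\<lambda>h. h *\<^sub>R (\<chi> j. a $ j * v (t - t0) $ j - weighted_mean a (v (t - t0)))) \<le> C" if "t \<in> {t0..T}" for t
          using C(2)[OF that] by (subst onorm_scaleR_left) (auto simp: onorm_id)
      qed (use C in auto)
      then show "abs_cont_on {t0..T} (\<lambda>t. v (t - t0))"
        by (rule lipschitz_on_imp_abs_cont_on)
    qed
    show "AE t in lebesgue. t \<in> {t0..T} \<longrightarrow> (\<exists>D\<le>0. (G has_real_derivative D) (at t within {t0..T}))"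
      using dyn
    proof (rule eventually_mono, intro impI)
      fix t
      assume "t \<in> {0..T} \<longrightarrow>
        (lam has_vector_derivative (\<chi> j. P t $ j - a $ j * lam t $ j)) (at t within {0..T}) \<and>
        0 \<le> (\<Sum>j\<in>UNIV. lam t $ j) \<and>
        (\<forall>j k. lam T $ j \<le> lam T $ k \<longrightarrow> P t $ k \<le> P t $ j)"
        and t: "t \<in> {t0..T}"
      then have lam_deriv: "(lam has_vector_derivative (\<chi> j. P t $ j - a $ j * lam t $ j)) (at t within {0..T})"
        and sum_nonneg: "0 \<le> (\<Sum>j\<in>UNIV. lam t $ j)"
        and P: "\<And>j k. lam T $ j \<le> lam T $ k \<Longrightarrow> P t $ k \<le> P t $ j"
        using t0 by auto
      have "(lam has_vector_derivative (\<chi> j. P t $ j - a $ j * lam t $ j)) (at t within {t0..T})"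
        using t0 by (intro has_vector_derivative_within_subset[OF lam_deriv]) auto
      from bounded_bilinear.has_vector_derivative[OF bounded_bilinear_inner v_shift this]
      have "(G has_real_derivative v (t - t0) \<bullet> (\<chi> j. P t $ j - a $ j * lam t $ j) +
          (\<chi> j. a $ j * v (t - t0) $ j - weighted_mean a (v (t - t0))) \<bullet> lam t) (at t within {t0..T})"
        unfolding G_def has_real_derivative_iff_has_vector_derivative .
      \<comment> \<open>The diagonal terms of the costate equation and of the flow cancel; this is
        the reason for evolving \<open>v\<close> with the opposite sign of \<open>a\<close>.\<close>
      moreover have "v (t - t0) \<bullet> (\<chi> j. P t $ j - a $ j * lam t $ j) +
          (\<chi> j. a $ j * v (t - t0) $ j - weighted_mean a (v (t - t0))) \<bullet> lam t =
          (\<Sum>j\<in>UNIV. v (t - t0) $ j * P t $ j) - weighted_mean a (v (t - t0)) * (\<Sum>j\<in>UNIV. lam t $ j)"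
        unfolding inner_vec_def sum_distrib_left sum.distrib[symmetric] sum_subtractf[symmetric]
        by (rule sum.cong) (auto simp: algebra_simps)
      \<comment> \<open>\<open>- P t\<close> is ordered like \<open>lam T\<close>, hence crosses in
        step with the signs of \<open>v (t - t0)\<close>.\<close>
      moreover have "0 \<le> (\<Sum>j\<in>UNIV. v (t - t0) $ j * - P t $ j)"
        using cross[of "t - t0"] t by (intro single_crossing_sum_nonneg v_sum) (simp add: P less_imp_le)
      then have "(\<Sum>j\<in>UNIV. v (t - t0) $ j * P t $ j) \<le> 0"
        by (simp add: sum_negf)
      moreover have "0 \<le> weighted_mean a (v (t - t0)) * (\<Sum>j\<in>UNIV. lam t $ j)"
        using v_M sum_nonneg by simp
      ultimately show "\<exists>D\<le>0. (G has_real_derivative D) (at t within {t0..T})"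
        by (intro exI[of _ "(\<Sum>j\<in>UNIV. v (t - t0) $ j * P t $ j) - weighted_mean a (v (t - t0)) * (\<Sum>j\<in>UNIV. lam t $ j)"]) auto
    qed
  qed
  moreover have "0 < G T"
  proof -
    \<comment> \<open>Zero entries at both \<open>j1\<close> and \<open>j2\<close> would contradict
      the gap \<open>a $ j1 - a $ j2 > 0\<close>.\<close>
    obtain i where "v (T - t0) $ i \<noteq> 0"
      using v_mono[of "T - t0" j2 j1] strict t0 by fastforce
    then show ?thesis
      unfolding G_def inner_vec_def inner_real_def
      using cross[of "T - t0"] t0 by (intro single_crossing_sum_pos[OF v_sum]) auto
  qed
  ultimately have "0 < v 0 \<bullet> lam t0"
    by (simp add: G_def)
  then show ?thesis
    by (simp add: inner_vec_def v_0 left_diff_distrib sum_subtractf sum_distrib_left)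
qed

section \<open>Multipliers along the optimal trajectory\<close>

text \<open>Nonempty open sets are not null. This upgrades almost-everywhere conditions on
  continuous functions to conditions at every point of an open set.\<close>

lemma open_AE_notin_imp_empty:
  fixes W :: "'a::euclidean_space set"
  assumes "open W" "AE t in lborel. t \<notin> W"
  shows "W = {}"
proof (rule ccontr)
  assume "W \<noteq> {}"
  have "W \<in> null_sets lborel"
    using assms by (subst AE_iff_null_sets) auto
  then have "negligible W"
    unfolding negligible_iff_null_sets by (rule null_sets_completionI)
  then show False
    using open_not_negligible[OF \<open>open W\<close> \<open>W \<noteq> {}\<close>] by simp
qed

lemma AE_lborel_finite_notin:
  assumes "finite (E :: 'a::euclidean_space set)"
  shows "AE t in lborel. t \<notin> E"
  using assms by (intro AE_not_in) (auto intro: countable_imp_null_set_lborel countable_finite)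

text \<open>A nonzero value of \<open>m\<close> at a common continuity point persists nearby. There
  slackness makes \<open>q\<close> vanish almost everywhere, hence everywhere by continuity, which
  yields an interval of the excluded kind. The finitely many other points form a null set.\<close>

lemma pw_cont_multiplier_eq_0:
  fixes m q :: "real \<Rightarrow> real"
  assumes m: "pw_cont T m"
    and q: "finite E" "\<And>t. t \<in> {0..T} - E \<Longrightarrow> continuous (at t within {0..T}) q"
    and slack: "AE t in lborel. t \<in> {0..T} \<longrightarrow> m t \<noteq> 0 \<longrightarrow> q t = 0"
    and no_interval: "\<not> (\<exists>t1 t2. 0 \<le> t1 \<and> t1 < t2 \<and> t2 \<le> T \<and> (\<forall>t\<in>{t1..t2}. q t = 0))"
  shows "AE t in lborel. t \<in> {0..T} \<longrightarrow> m t = 0"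
proof -
  obtain D where D: "finite D" "\<And>t. t \<in> {0..T} - D \<Longrightarrow> continuous (at t within {0..T}) m"
    using m unfolding pw_cont_def by blast
  \<comment> \<open>The end points are removed as well, so that \<open>S\<close> is open and
    continuity within \<open>{0..T}\<close> is two-sided on it.\<close>
  define S where "S = {0<..<T} - (D \<union> E)"
  have "open S"
    unfolding S_def using D(1) q(1) by (intro open_Diff finite_imp_closed) auto
  have "isCont m t \<and> isCont q t" if "t \<in> S" for t
  proof -
    have "t \<in> {0..T} - D" "t \<in> {0..T} - E"
      using that by (auto simp: S_def)
    moreover have "at t within {0..T} = at t"
      using that by (intro at_within_interior) (simp add: S_def)
    ultimately show ?thesis
      using D(2) q(2) by metis
  qed
  then have "continuous_on S m" "continuous_on S q"
    by (auto intro!: continuous_at_imp_continuous_on)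
  define W where "W = S \<inter> m -` (- {0})"
  have "open W"
    unfolding W_def using \<open>continuous_on S m\<close> \<open>open S\<close> by (intro continuous_open_preimage) auto
  have "continuous_on W q"
    using \<open>continuous_on S q\<close> by (rule continuous_on_subset) (auto simp: W_def)
  then have "open (W \<inter> q -` (- {0}))"
    using \<open>open W\<close> by (intro continuous_open_preimage) auto
  moreover have "AE t in lborel. t \<notin> W \<inter> q -` (- {0})"
    using slack by (rule eventually_mono) (auto simp: W_def S_def)
  ultimately have "W \<inter> q -` (- {0}) = {}"
    by (rule open_AE_notin_imp_empty)
  have "W = {}"
  proof (rule ccontr)
    assume "W \<noteq> {}"
    then obtain t e where e: "0 < e" "cball t e \<subseteq> W"
      using \<open>open W\<close> open_contains_cball by blast
    then have "{t - e..t + e} \<subseteq> W"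
      by (simp add: cball_eq_atLeastAtMost)
    then have zero: "\<forall>t\<in>{t - e..t + e}. q t = 0" and sub: "{t - e..t + e} \<subseteq> {0<..<T}"
      using \<open>W \<inter> q -` (- {0}) = {}\<close> by (auto simp: W_def S_def)
    have "t - e \<in> {0<..<T}" "t + e \<in> {0<..<T}"
      using \<open>0 < e\<close> by (intro subsetD[OF sub]; simp)+
    then have "0 \<le> t - e" "t - e < t + e" "t + e \<le> T"
      using \<open>0 < e\<close> by auto
    then show False
      using no_interval zero by blast
  qed
  then have "\<forall>t\<in>S. m t = 0"
    unfolding W_def by blast
  moreover have "AE t in lborel. t \<notin> {0, T} \<union> (D \<union> E)"
    using D(1) q(1) by (intro AE_lborel_finite_notin) simp
  ultimately show ?thesis
    by (elim eventually_mono) (auto simp: S_def)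
qed

lemma sum_lessThan_add:
  fixes X :: "nat \<Rightarrow> 'a::comm_monoid_add"
  shows "(\<Sum>i<m + n. X i) = (\<Sum>i<m. X i) + (\<Sum>i<n. X (m + i))"
  by (induction n) (simp_all add: add.assoc)

lemma C1_fun_isCont: "C1_fun q \<Longrightarrow> isCont q p"
  unfolding C1_fun_def using differentiable_imp_continuous_within by blast

theorem theorem3:
  fixes a :: "real^'n"
    and f g :: "real^'n \<Rightarrow> real^'n"
    and F :: "real^'n \<Rightarrow> real \<Rightarrow> real^'n"
    and l phi :: "real^'n \<Rightarrow> real"
    and s :: "real^'n \<Rightarrow> real \<Rightarrow> nat \<Rightarrow> real"
    and h z :: "real^'n \<Rightarrow> nat \<Rightarrow> real"
    and cs ch cz :: nat
    and umin umax :: real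
    and x0 :: "real^'n"
    and tf_free :: bool
    and tf :: real
    and xs :: "real \<Rightarrow> real^'n"
    and us :: "real \<Rightarrow> real"
    and lam0 :: real
    and lam :: "real \<Rightarrow> real^'n"
    and mu nu :: "real \<Rightarrow> nat \<Rightarrow> real"
    and alpha gamma :: "nat \<Rightarrow> real"
  assumes f_diag: "\<forall>x. f x = (\<chi> j. a $ j * x $ j)"
    and g_ones: "\<forall>x. g x = (\<chi> j. 1)"
    and F_def: "F = (\<lambda>x u. f x + u *\<^sub>R g x)"
    and input_bounds: "\<exists>i1<cs. \<exists>i2<cs. \<forall>x u. s x u i1 = umin - u \<and> s x u i2 = u - umax"
    and optimal: "oc_optimal tf_free F phi l s h z cs ch cz x0 tf xs us"
    \<comment> \<open>Assumption 1(a)\<close>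
    and A1a_phi: "C1_fun phi"
    and A1a_l: "C1_fun l"
    and A1a_s: "\<forall>i<cs. C1_fun (\<lambda>(x, u). s x u i)"
    and A1a_z: "\<forall>i<cz. C1_fun (\<lambda>x. z x i)"
    and A1a_h: "\<forall>i<ch. C2_fun (\<lambda>x. h x i)"
    \<comment> \<open>Assumption 1(b)\<close>
    and A1b: "AE t in lborel. t \<in> {0..tf} \<longrightarrow>
      full_row_rank (cs + ch) {..<1 + cs + ch}
        (\<lambda>i col. if col = 0 then pd_u (sbar s h F cs i) (xs t) (us t)
                 else if col = Suc i then (if i < cs then s (xs t) (us t) i else h (xs t) (i - cs))
                 else 0)"
    \<comment> \<open>Assumption 4(a)\<close>
    and A4a_l: "\<forall>x. l x = 0"
    and A4a_rank: "full_row_rank (Suc cz) (range Inl \<union> Inr ` {..<cz})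
        (\<lambda>i col. case col of
            Inl j \<Rightarrow> (if i = 0 then grad_x phi (xs tf) j else grad_x (\<lambda>x. z x (i - 1)) (xs tf) j)
          | Inr k \<Rightarrow> (if i = Suc k then z (xs tf) k else 0))"
    \<comment> \<open>Assumption 5 and absence of contact times\<close>
    and A5a_0: "G_at h ch xs 0 = G_right h ch xs 0"
    and A5a_tf: "G_at h ch xs tf = G_left h ch xs tf"
    and A5b: "\<forall>\<tau>\<in>{0<..<tf}. entry_time h ch tf xs \<tau> \<longrightarrow> \<not> continuous (at \<tau>) us"
    and no_contact: "\<forall>t\<in>{0<..<tf}. \<not> contact_time h ch xs t"
    \<comment> \<open>Hypothesis (P), combined with Fact (F) (lambda continuous, jumps eta = 0, gamma = 0)\<close>
    and P_lam0: "lam0 \<le> 0"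
    and F_lam_cont: "continuous_on {0..tf} lam"
    and P_lam_ac: "abs_cont_on {0..tf} lam"
    and P_mu_pw: "\<forall>i<cs. pw_cont tf (\<lambda>t. mu t i)"
    and P_nu_pw: "\<forall>i<ch. pw_cont tf (\<lambda>t. nu t i)"
    and P_nontriv: "\<forall>t\<in>{0..tf}. \<not> (lam0 = 0 \<and> lam t = 0 \<and> (\<forall>i<cs. mu t i = 0) \<and>
        (\<forall>i<ch. nu t i = 0) \<and> (\<forall>i<cz. alpha i = 0) \<and> (\<forall>i<ch. gamma i = 0))"
    and P_max: "AE t in lborel. t \<in> {0..tf} \<longrightarrow>
        (lam0 * l (xs t) + lam t \<bullet> F (xs t) (us t)) \<in>
           (\<lambda>v. lam0 * l (xs t) + lam t \<bullet> F (xs t) v) ` ctrl_set s h F cs ch (xs t) \<and>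
        (\<forall>v\<in>ctrl_set s h F cs ch (xs t).
           lam0 * l (xs t) + lam t \<bullet> F (xs t) v \<le> lam0 * l (xs t) + lam t \<bullet> F (xs t) (us t))"
    and P_stat: "AE t in lborel. t \<in> {0..tf} \<longrightarrow>
        lam t \<bullet> g (xs t) + (\<Sum>i<cs. mu t i * pd_u (sbar s h F cs i) (xs t) (us t))
          + (\<Sum>i<ch. nu t i * pd_u (sbar s h F cs (cs + i)) (xs t) (us t)) = 0"
    and P_costate: "AE t in lborel. t \<in> {0..tf} \<longrightarrow>
        (lam has_vector_derivative
          (\<chi> j. - lam0 * grad_x l (xs t) j - lam t \<bullet> jacF_col F (xs t) (us t) j
                - (\<Sum>i<cs. mu t i * pd_x (sbar s h F cs i) (xs t) (us t) j)
                - (\<Sum>i<ch. nu t i * pd_x (sbar s h F cs (cs + i)) (xs t) (us t) j)))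
          (at t within {0..tf})"
    and P_mu_sign: "AE t in lborel. t \<in> {0..tf} \<longrightarrow>
        (\<forall>i<cs. mu t i \<le> 0) \<and> (\<Sum>i<cs. mu t i * s (xs t) (us t) i) = 0"
    and P_nu_sign: "AE t in lborel. t \<in> {0..tf} \<longrightarrow>
        (\<forall>i<ch. nu t i \<le> 0) \<and> (\<Sum>i<ch. nu t i * h (xs t) i) = 0"
    and P_transv: "\<forall>j. lam tf $ j = lam0 * grad_x phi (xs tf) j
        + (\<Sum>i<cz. alpha i * grad_x (\<lambda>x. z x i) (xs tf) j)
        + (\<Sum>i<ch. gamma i * grad_x (\<lambda>x. h x i) (xs tf) j)"
    and P_alpha: "\<forall>i<cz. 0 \<le> alpha i" "(\<Sum>i<cz. alpha i * z (xs tf) i) = 0"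
    and P_gamma: "\<forall>i<ch. gamma i \<le> 0" "(\<Sum>i<ch. gamma i * h (xs tf) i) = 0"
    and F_gamma: "\<forall>i<ch. gamma i = 0"
    and P_free: "tf_free \<longrightarrow> (\<forall>t\<in>{0..tf}. lam0 * l (xs t) + lam t \<bullet> F (xs t) (us t) = 0)"
    \<comment> \<open>Hypotheses (a), (b), (c) of the theorem; lambda(tf-) = lam tf by continuity\<close>
    and hyp_a: "\<exists>j1 j2. lam tf $ j1 > lam tf $ j2 \<and> a $ j1 > a $ j2"
    and hyp_b: "\<forall>k j. lam tf $ k \<ge> lam tf $ j \<longrightarrow> a $ k \<ge> a $ j"
    and hyp_c: "\<forall>i < cs + ch.
        (\<exists>t1 t2. 0 \<le> t1 \<and> t1 < t2 \<and> t2 \<le> tf \<and> (\<forall>t\<in>{t1..t2}. sbar_active s h cs xs us i t)) \<longrightarrow>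
        (AE t in lborel. t \<in> {0..tf} \<and> sbar_active s h cs xs us i t \<longrightarrow>
           pd_u (sbar s h F cs i) (xs t) (us t) > 0 \<and>
           (\<forall>k j. lam tf $ k \<ge> lam tf $ j \<longrightarrow>
              rel_sens s h F cs i (xs t) (us t) k \<le> rel_sens s h F cs i (xs t) (us t) j))"
  shows "(AE t in lborel. t \<in> {0..tf} \<longrightarrow>
            lam t \<bullet> g (xs t) > 0 \<and> us t \<in> ctrl_set s h F cs ch (xs t) \<and>
            (\<forall>v\<in>ctrl_set s h F cs ch (xs t). v \<le> us t)) \<and>
         (AE t in lborel. t \<in> {0..tf} \<longrightarrow>
            (\<exists>i<cs. s (xs t) (us t) i = 0) \<or> (\<exists>i<ch. h (xs t) i = 0))"
proof -
  \<comment> \<open>A single index covers both kinds of constraints, as in \<open>sbar\<close>. For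
    state constraints \<open>q\<close> is the constraint itself whereas \<open>du\<close> and
    \<open>dx\<close> differentiate its \<open>hdot\<close>, so that \<open>q i t = 0\<close>
    expresses activity.\<close>
  define n where "n = cs + ch"
  define m where "m t i = (if i < cs then mu t i else nu t (i - cs))" for t i
  define q where "q i t = (if i < cs then s (xs t) (us t) i else h (xs t) (i - cs))" for i t
  define du where "du i t = pd_u (sbar s h F cs i) (xs t) (us t)" for i t
  define dx where "dx i t j = pd_x (sbar s h F cs i) (xs t) (us t) j" for i t j
  define P where "P t = (\<chi> j. - (\<Sum>i<n. m t i * dx i t j))" for t
  define \<sigma> where "\<sigma> t = (\<Sum>j\<in>UNIV. lam t $ j)" for t

  \<comment> \<open>Consequences of linearity and feasibility\<close>
  have m_sum: "(\<Sum>i<n. m t i * X i) = (\<Sum>i<cs. mu t i * X i) + (\<Sum>i<ch. nu t i * X (cs + i))" for t X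
    unfolding n_def sum_lessThan_add by (simp add: m_def)
  have active_iff: "sbar_active s h cs xs us i t \<longleftrightarrow> q i t = 0" for i t
    by (simp add: sbar_active_def q_def)
  have lam_g: "lam t \<bullet> g x = \<sigma> t" for t x
    using g_ones by (simp add: inner_vec_def \<sigma>_def)
  have F_eq: "F x v = (\<chi> j. a $ j * x $ j) + v *\<^sub>R g x" for x v
    using F_def f_diag by simp
  have lam_jacF: "lam t \<bullet> jacF_col F x v j = a $ j * lam t $ j" for t x v j
  proof -
    have "linear (\<lambda>y::real^'n. \<chi> k. a $ k * y $ k)"
      by (rule linearI) (simp_all add: vec_eq_iff algebra_simps)
    then have "((\<lambda>y. (\<chi> k. a $ k * y $ k) + v *\<^sub>R (\<chi> j. 1)) has_derivative (\<lambda>y. \<chi> k. a $ k * y $ k)) (at x)"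
      by (intro has_derivative_add_const bounded_linear_imp_has_derivative)
        (simp add: linear_conv_bounded_linear)
    then have "((\<lambda>y. F y v) has_derivative (\<lambda>y. \<chi> k. a $ k * y $ k)) (at x)"
      by (simp add: F_eq g_ones)
    then have "jacF_col F x v j = (\<chi> k. a $ k * axis j 1 $ k)"
      unfolding jacF_col_def by (metis frechet_derivative_at)
    then show ?thesis
      by (simp add: inner_vec_def axis_def if_distrib[of "\<lambda>x. _ * x"] mult.commute cong: if_cong)
  qed
  have grad_l: "grad_x l x j = 0" for x j
  proof -
    have "l = (\<lambda>x. 0)"
      using A4a_l by auto
    then show ?thesis
      by (simp add: grad_x_def)
  qed

  have feas: "feasible F s h z cs ch cz x0 tf xs us"
    using optimal unfolding oc_optimal_def by blast
  then have xs_cont: "continuous_on {0..tf} xs"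
    and s_le: "\<And>t i. t \<in> {0..tf} \<Longrightarrow> i < cs \<Longrightarrow> s (xs t) (us t) i \<le> 0"
    and h_le: "\<And>t i. t \<in> {0..tf} \<Longrightarrow> i < ch \<Longrightarrow> h (xs t) i \<le> 0"
    unfolding feasible_def is_solution_def by auto
  obtain E where E: "finite E" "\<And>t. t \<in> {0..tf} - E \<Longrightarrow> continuous (at t within {0..tf}) us"
    using feas unfolding feasible_def admissible_input_def by blast
  have q_cont: "continuous (at t within {0..tf}) (q i)" if i: "i < n" and t: "t \<in> {0..tf} - E" for i t
  proof -
    have x: "(xs \<longlongrightarrow> xs t) (at t within {0..tf})"
      using xs_cont t unfolding continuous_on_def by blast
    have u: "(us \<longlongrightarrow> us t) (at t within {0..tf})"
      using E(2)[OF t] unfolding continuous_within .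
    show ?thesis
    proof (cases "i < cs")
      case True
      then have "isCont (\<lambda>(x, u). s x u i) (xs t, us t)"
        using A1a_s C1_fun_isCont by blast
      from isCont_tendsto_compose[OF this tendsto_Pair[OF x u]] show ?thesis
        using True by (simp add: continuous_within q_def[abs_def])
    next
      case False
      then have "isCont (\<lambda>x. h x (i - cs)) (xs t)"
        using A1a_h i unfolding C2_fun_def n_def by (auto intro!: C1_fun_isCont)
      from isCont_tendsto_compose[OF this x] show ?thesis
        using False by (simp add: continuous_within q_def[abs_def])
    qed
  qed

  \<comment> \<open>Signs, slackness and sensitivities of the multipliers\<close>
  have m_nonpos: "AE t in lborel. t \<in> {0..tf} \<longrightarrow> (\<forall>i<n. m t i \<le> 0)"
    using P_mu_sign P_nu_sign by eventually_elim (auto simp: m_def n_def)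
  have slack: "AE t in lborel. t \<in> {0..tf} \<longrightarrow> (\<forall>i<n. m t i \<noteq> 0 \<longrightarrow> q i t = 0)"
    using P_mu_sign P_nu_sign
  proof eventually_elim
    case (elim t)
    show ?case
    proof (intro impI allI)
      fix i
      assume t: "t \<in> {0..tf}" and i: "i < n" "m t i \<noteq> 0"
      \<comment> \<open>Both factors are nonpositive, so a sum that vanishes forces every term to
        vanish.\<close>
      have "0 \<le> mu t i * s (xs t) (us t) i" if "i < cs" for i
        using elim t s_le that by (simp add: mult_nonpos_nonpos)
      then have "\<forall>i\<in>{..<cs}. mu t i * s (xs t) (us t) i = 0"
        using elim t by (subst sum_nonneg_eq_0_iff[symmetric]) auto
      moreover have "0 \<le> nu t i * h (xs t) i" if "i < ch" for i
        using elim t h_le that by (simp add: mult_nonpos_nonpos)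
      then have "\<forall>i\<in>{..<ch}. nu t i * h (xs t) i = 0"
        using elim t by (subst sum_nonneg_eq_0_iff[symmetric]) auto
      ultimately show "q i t = 0"
        using i by (auto simp: q_def m_def n_def split: if_splits)
    qed
  qed
  \<comment> \<open>Hypothesis (c) only concerns constraints that are active on an interval. A multiplier that
    does not vanish at one of its continuity points makes its constraint such a one.\<close>
  have sensitivity: "AE t in lborel. t \<in> {0..tf} \<longrightarrow> (\<forall>i<n. m t i \<noteq> 0 \<longrightarrow> 0 < du i t \<and>
      (\<forall>j k. lam tf $ j \<le> lam tf $ k \<longrightarrow> inverse (du i t) * dx i t k \<le> inverse (du i t) * dx i t j))"
  proof -
    have "AE t in lborel. t \<in> {0..tf} \<longrightarrow> m t i \<noteq> 0 \<longrightarrow> 0 < du i t \<and>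
        (\<forall>j k. lam tf $ j \<le> lam tf $ k \<longrightarrow> inverse (du i t) * dx i t k \<le> inverse (du i t) * dx i t j)"
      if "i < n" for i
    proof (cases "\<exists>t1 t2. 0 \<le> t1 \<and> t1 < t2 \<and> t2 \<le> tf \<and> (\<forall>t\<in>{t1..t2}. q i t = 0)")
      case True
      then have "AE t in lborel. t \<in> {0..tf} \<and> q i t = 0 \<longrightarrow> 0 < du i t \<and>
          (\<forall>k j. lam tf $ k \<ge> lam tf $ j \<longrightarrow>
            rel_sens s h F cs i (xs t) (us t) k \<le> rel_sens s h F cs i (xs t) (us t) j)"
        using hyp_c \<open>i < n\<close> unfolding active_iff n_def du_def by blast
      then show ?thesis
        using slack by eventually_elim (use \<open>i < n\<close> in \<open>auto simp: rel_sens_def du_def dx_def\<close>)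
    next
      case False
      have "pw_cont tf (\<lambda>t. m t i)"
        using P_mu_pw P_nu_pw \<open>i < n\<close> by (cases "i < cs") (auto simp: m_def n_def)
      then have "AE t in lborel. t \<in> {0..tf} \<longrightarrow> m t i = 0"
        using E(1) q_cont[OF \<open>i < n\<close>] _ False
      proof (rule pw_cont_multiplier_eq_0)
        show "AE t in lborel. t \<in> {0..tf} \<longrightarrow> m t i \<noteq> 0 \<longrightarrow> q i t = 0"
          using slack by eventually_elim (use \<open>i < n\<close> in auto)
      qed
      then show ?thesis
        by eventually_elim auto
    qed
    then have "AE t in lborel. \<forall>i\<in>{..<n}. t \<in> {0..tf} \<longrightarrow> m t i \<noteq> 0 \<longrightarrow> 0 < du i t \<and>
        (\<forall>j k. lam tf $ j \<le> lam tf $ k \<longrightarrow> inverse (du i t) * dx i t k \<le> inverse (du i t) * dx i t j)"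
      by (intro AE_finite_allI) auto
    then show ?thesis
      by eventually_elim auto
  qed

  \<comment> \<open>Switching function and costate equation in terms of weights\<close>
  have sigma: "AE t in lborel. t \<in> {0..tf} \<longrightarrow> \<sigma> t = (\<Sum>i<n. - (m t i * du i t))"
    using P_stat by eventually_elim (auto simp: lam_g sum_negf m_sum du_def)
  have weights: "AE t in lborel. t \<in> {0..tf} \<longrightarrow> (\<forall>i<n. 0 \<le> - (m t i * du i t))"
    using m_nonpos sensitivity
  proof eventually_elim
    case (elim t)
    show ?case
    proof (intro impI allI)
      fix i
      assume "t \<in> {0..tf}" "i < n"
      then have "m t i \<le> 0" "m t i \<noteq> 0 \<Longrightarrow> 0 < du i t"
        using elim by auto
      \<comment> \<open>Where \<open>m t i = 0\<close> nothing is known about \<open>du i t\<close>,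
        but the weight vanishes.\<close>
      then show "0 \<le> - (m t i * du i t)"
        by (cases "m t i = 0") (auto simp: mult_nonpos_nonneg)
    qed
  qed
  have sigma_nonneg: "AE t in lborel. t \<in> {0..tf} \<longrightarrow> 0 \<le> \<sigma> t"
    using sigma weights by eventually_elim (auto intro!: sum_nonneg)
  have P_order: "AE t in lborel. t \<in> {0..tf} \<longrightarrow> (\<forall>j k. lam tf $ j \<le> lam tf $ k \<longrightarrow> P t $ k \<le> P t $ j)"
    using sensitivity weights
  proof eventually_elim
    case (elim t)
    show ?case
    proof (intro impI allI)
      fix j k
      assume t: "t \<in> {0..tf}" and jk: "lam tf $ j \<le> lam tf $ k"
      have "m t i * dx i t j \<le> m t i * dx i t k" if "i < n" for i
      proof (cases "m t i = 0")
        case False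
        then have sens: "0 < du i t" "inverse (du i t) * dx i t k \<le> inverse (du i t) * dx i t j"
          using elim t jk \<open>i < n\<close> by auto
        have "0 \<le> - (m t i * du i t)"
          using elim t \<open>i < n\<close> by blast
        \<comment> \<open>Multiplying a relative sensitivity by its weight cancels
          \<open>inverse (du i t)\<close> and leaves \<open>- m t i * dx i t j\<close>, a summand of
          \<open>P t $ j\<close>.\<close>
        with sens(2) have "- (m t i * du i t) * (inverse (du i t) * dx i t k) \<le> - (m t i * du i t) * (inverse (du i t) * dx i t j)"
          by (rule mult_left_mono)
        then show ?thesis
          using \<open>0 < du i t\<close> by (simp add: field_simps)
      qed simp
      then show "P t $ k \<le> P t $ j"
        by (auto simp: P_def intro!: sum_mono)
    qed
  qed
  have "(\<chi> j. - lam0 * grad_x l (xs t) j - lam t \<bullet> jacF_col F (xs t) (us t) j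
        - (\<Sum>i<cs. mu t i * pd_x (sbar s h F cs i) (xs t) (us t) j)
        - (\<Sum>i<ch. nu t i * pd_x (sbar s h F cs (cs + i)) (xs t) (us t) j)) =
      (\<chi> j. P t $ j - a $ j * lam t $ j)" for t
    by (simp add: P_def m_sum dx_def lam_jacF grad_l vec_eq_iff)
  with P_costate have costate: "AE t in lborel. t \<in> {0..tf} \<longrightarrow>
      (lam has_vector_derivative (\<chi> j. P t $ j - a $ j * lam t $ j)) (at t within {0..tf})"
    by simp

  \<comment> \<open>Strict positivity of the switching function\<close>
  have pos: "(\<Sum>i\<in>UNIV. a $ i) / real CARD('n) * \<sigma> t < (\<Sum>j\<in>UNIV. a $ j * lam t $ j)"
    if "t \<in> {0..tf}" for t
  proof -
    have dyn: "AE t in lborel. t \<in> {0..tf} \<longrightarrow>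
      (lam has_vector_derivative (\<chi> j. P t $ j - a $ j * lam t $ j)) (at t within {0..tf}) \<and>
      0 \<le> (\<Sum>j\<in>UNIV. lam t $ j) \<and>
      (\<forall>j k. lam tf $ j \<le> lam tf $ k \<longrightarrow> P t $ k \<le> P t $ j)"
      using costate sigma_nonneg P_order by eventually_elim (simp add: \<sigma>_def)
    obtain j1 j2 where "a $ j2 < a $ j1"
      using hyp_a by blast
    then show ?thesis
      unfolding \<sigma>_def using hyp_b
      by (intro centered_costate_pos[OF that P_lam_ac F_lam_cont AE_completion[OF dyn]]) auto
  qed

  \<comment> \<open>The local minimum argument compares \<sigma> with its values at all nearby
    times, so the almost-everywhere sign must first be extended by continuity.\<close>
  have sigma_interior: "0 \<le> \<sigma> t" if "t \<in> {0<..<tf}" for t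
  proof -
    have "continuous_on {0<..<tf} \<sigma>"
      unfolding \<sigma>_def
      by (intro continuous_intros continuous_on_subset[OF F_lam_cont]) auto
    then have "open ({0<..<tf} \<inter> \<sigma> -` {..<0})"
      by (intro continuous_open_preimage) auto
    moreover have "AE t in lborel. t \<notin> {0<..<tf} \<inter> \<sigma> -` {..<0}"
      using sigma_nonneg by eventually_elim auto
    ultimately have "{0<..<tf} \<inter> \<sigma> -` {..<0} = {}"
      by (rule open_AE_notin_imp_empty)
    with that show ?thesis
      by force
  qed

  \<comment> \<open>The end points are discarded because a minimum there would not force the
    derivative to be 0.\<close>
  have boundary: "AE t in lborel. t \<notin> {0, tf}"
    by (rule AE_lborel_finite_notin) simp
  have sigma_pos: "AE t in lborel. t \<in> {0..tf} \<longrightarrow> 0 < \<sigma> t"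
    using boundary costate sigma weights sensitivity
  proof eventually_elim
    case (elim t)
    show ?case
    proof (rule impI, rule ccontr)
      assume t: "t \<in> {0..tf}" and "\<not> 0 < \<sigma> t"
      then have interior: "t \<in> {0<..<tf}"
        using elim by auto
      then have "\<sigma> t = 0"
        using sigma_interior \<open>\<not> 0 < \<sigma> t\<close> by fastforce
      then have "\<forall>i\<in>{..<n}. - (m t i * du i t) = 0"
        using elim t by (subst sum_nonneg_eq_0_iff[symmetric]) auto
      \<comment> \<open>A vanishing weight means a vanishing multiplier, since \<open>du i t\<close>
        is positive wherever \<open>m t i\<close> is nonzero.\<close>
      then have "\<forall>i<n. m t i = 0"
        using elim t by force
      then have "P t = 0"
        by (simp add: P_def vec_eq_iff)
      have "at t within {0..tf} = at t"
        using interior by (intro at_within_interior) simp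
      then have "(lam has_vector_derivative (\<chi> j. - (a $ j * lam t $ j))) (at t)"
        using elim t \<open>P t = 0\<close> by simp
      then have "((\<lambda>t. lam t $ j) has_real_derivative - (a $ j * lam t $ j)) (at t)" for j
        using bounded_linear.has_vector_derivative[OF bounded_linear_vec_nth]
        by (fastforce simp: has_real_derivative_iff_has_vector_derivative)
      then have "(\<sigma> has_real_derivative (\<Sum>j\<in>UNIV. - (a $ j * lam t $ j))) (at t)"
        unfolding \<sigma>_def by (intro DERIV_sum)
      \<comment> \<open>This radius keeps all compared times inside
        \<open>{0<..<tf}\<close>.\<close>
      moreover have "0 < min t (tf - t)"
        using interior by simp
      moreover have "\<forall>y. \<bar>t - y\<bar> < min t (tf - t) \<longrightarrow> \<sigma> t \<le> \<sigma> y"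
        using sigma_interior \<open>\<sigma> t = 0\<close> by (auto simp: abs_less_iff)
      ultimately have "(\<Sum>j\<in>UNIV. - (a $ j * lam t $ j)) = 0"
        by (rule DERIV_local_min)
      \<comment> \<open>At a zero of \<sigma>, \<open>pos\<close> makes this derivative
        negative.\<close>
      then show False
        using pos[OF t] \<open>\<sigma> t = 0\<close> by (simp add: sum_negf)
    qed
  qed

  \<comment> \<open>The maximal control and the active constraint\<close>
  have "AE t in lborel. t \<in> {0..tf} \<longrightarrow> 0 < lam t \<bullet> g (xs t) \<and> us t \<in> ctrl_set s h F cs ch (xs t) \<and>
      (\<forall>v\<in>ctrl_set s h F cs ch (xs t). v \<le> us t)"
    using sigma_pos P_max
  proof eventually_elim
    case (elim t)
    show ?case
    proof
      assume "t \<in> {0..tf}"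
      \<comment> \<open>The Hamiltonian is affine in the control with slope \<sigma>. By
        \<open>P_max\<close> its value at \<open>us t\<close> is attained somewhere in the control
        set, and the positive slope identifies that element with \<open>us t\<close>; this gives
        membership as well as maximality.\<close>
      have H: "lam t \<bullet> F (xs t) v = lam t \<bullet> (\<chi> j. a $ j * xs t $ j) + v * \<sigma> t" for v
        by (simp add: F_eq inner_add_right lam_g)
      show "0 < lam t \<bullet> g (xs t) \<and> us t \<in> ctrl_set s h F cs ch (xs t) \<and>
          (\<forall>v\<in>ctrl_set s h F cs ch (xs t). v \<le> us t)"
        using elim \<open>t \<in> {0..tf}\<close> by (auto simp: H lam_g)
    qed
  qed
  moreover have "AE t in lborel. t \<in> {0..tf} \<longrightarrow>
      (\<exists>i<cs. s (xs t) (us t) i = 0) \<or> (\<exists>i<ch. h (xs t) i = 0)"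
    using sigma_pos sigma slack
  proof eventually_elim
    case (elim t)
    show ?case
    proof
      assume t: "t \<in> {0..tf}"
      \<comment> \<open>If every multiplier vanished, the weighted sum for \<sigma> would be
        0.\<close>
      then obtain i where "i < n" "m t i \<noteq> 0"
        using elim by (metis (no_types, lifting) lessThan_iff minus_zero mult_zero_left order_less_irrefl sum.neutral)
      then have "i < n" "q i t = 0"
        using elim t by auto
      then show "(\<exists>i<cs. s (xs t) (us t) i = 0) \<or> (\<exists>i<ch. h (xs t) i = 0)"
        unfolding q_def n_def by (metis add.commute less_diff_conv2 not_less)
    qed
  qed
  ultimately show ?thesis
    by blast
qed

end
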